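(* Let $G$ be a profinite group, $X$ a profinite $G$-space and $\mathcal{B}$ an open-closed basis of $X$. Equivariant sheafification defines a functor $\ell$ from the category of $G$-presheaves of sets over $\mathcal{B}$ to the category of $G$-sheaves of sets over $X$, which is left adjoint to the forgetful functor. The unit of this adjunction gives a canonical map $F\to\ell F$ from a $G$-presheaf to a $G$-sheaf. The canonical map $\ell F\to\ell^2F$ is an isomorphism. Furthermore, if $E$ is a $G$-sheaf, any map of $G$-presheaves $F\to E$ factors over $F\to\ell F$.
   Context: A profinite space is a compact, Hausdorff, totally disconnected space; a profinite group is a topological group whose underlying space is profinite. An open-closed basis is a basis of the topology consisting of sets that are both open and closed. A $G$-sheaf of sets over $X$ is a $G$-equivariant local homeomorphism $p\colon E\to X$ with $E$ a space with continuous left $G$-action; morphisms are continuous $G$-equivariant maps over $X$. Sections over an open set are all continuous sections, and $g\ast s=g\circ s\circ g^{-1}$. $\mathcal{O}_G(\mathcal{B})$ is the category with objects the elements of $\mathcal{B}$, morphism sets $\mathcal{O}_G(\mathcal{B})(U,V)=\{g\in G\mid gU\subseteq V\}$, and composition given by multiplication. A $G$-presheaf of sets over $\mathcal{B}$ is a functor $F\colon\mathcal{O}_G(\mathcal{B})^{op}\to\mathrm{Sets}$ such that for every $U\in\mathcal{B}$ the action of $\mathrm{stab}_G(U)=\{g\in G\mid gU=U\}$ (subspace topology) on $F(U)$ (discrete topology) is continuous; morphisms are natural transformations. The forgetful functor sends a $G$-sheaf $E$ to $U\mapsto\Gamma(U,E)$, where a morphism $g\colon U\to V$ acts by $s\mapsto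 g^{-1}\circ s|_{gU}\circ g$. Equivariant sheafification: $\ell F=\coprod_{x\in X}F_x$, $F_x=\operatorname{colim}_{x\in U\in\mathcal{B}}F(U)$, projecting $F_x$ to $x$, with topology generated by the sets $\{s_x\mid x\in U\}$ for $U\in\mathcal{B}$, $s\in F(U)$ ($s_x$ the germ of $s$ at $x$), and $G$-action: for $s\in F(U)$, $x\in U$, $g\in G$, choose $V\in\mathcal{B}$ with $gx\in V\subseteq gU$ and let $g(s_x)$ be the germ at $gx$ of the image of $s$ under $F(g^{-1}\colon V\to U)$ (when $gU\in\mathcal{B}$ one may take $V=gU$). This is a $G$-sheaf of sets over $X$. *)

theory Defs
  imports "HOL-Analysis.Analysis" "HOL-Algebra.Group_Action"
begin

section \<open>Profinite groups and profinite \<open>G\<close>-spaces\<close>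

definition totally_disconnected_space :: "'a topology \<Rightarrow> bool" where
  "totally_disconnected_space X \<longleftrightarrow> (\<forall>S. connectedin X S \<longrightarrow> (\<exists>a. S \<subseteq> {a}))"

definition profinite_space :: "'a topology \<Rightarrow> bool" where
  "profinite_space X \<longleftrightarrow>
     compact_space X \<and> Hausdorff_space X \<and> totally_disconnected_space X"

definition topological_group :: "('g, 'm) monoid_scheme \<Rightarrow> 'g topology \<Rightarrow> bool" where
  "topological_group G T \<longleftrightarrow>
     group G \<and> topspace T = carrier G \<and>
     continuous_map (prod_topology T T) T (\<lambda>(g, h). g \<otimes>\<^bsub>G\<^esub> h) \<and>
     continuous_map T T (\<lambda>g. inv\<^bsub>G\<^esub> g)"

definition profinite_group :: "('g, 'm) monoid_scheme \<Rightarrow> 'g topology \<Rightarrow> bool" where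
  "profinite_group G T \<longleftrightarrow> topological_group G T \<and> profinite_space T"

definition G_space ::
  "('g, 'm) monoid_scheme \<Rightarrow> 'g topology \<Rightarrow> 'x topology \<Rightarrow> ('g \<Rightarrow> 'x \<Rightarrow> 'x) \<Rightarrow> bool" where
  "G_space G T X \<phi> \<longleftrightarrow>
     group_action G (topspace X) \<phi> \<and>
     continuous_map (prod_topology T X) X (\<lambda>(g, x). \<phi> g x)"

definition open_closed_basis :: "'x topology \<Rightarrow> 'x set set \<Rightarrow> bool" where
  "open_closed_basis X \<B> \<longleftrightarrow>
     (\<forall>U\<in>\<B>. openin X U \<and> closedin X U) \<and>
     (\<forall>W x. openin X W \<and> x \<in> W \<longrightarrow> (\<exists>U\<in>\<B>. x \<in> U \<and> U \<subseteq> W))"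


section \<open>\<open>G\<close>-presheaves of sets\<close>

definition orbit_hom ::
  "('g, 'm) monoid_scheme \<Rightarrow> ('g \<Rightarrow> 'x \<Rightarrow> 'x) \<Rightarrow> 'x set \<Rightarrow> 'x set \<Rightarrow> 'g set" where
  "orbit_hom G \<phi> U V = {g \<in> carrier G. \<phi> g ` U \<subseteq> V}"

definition set_stabilizer ::
  "('g, 'm) monoid_scheme \<Rightarrow> ('g \<Rightarrow> 'x \<Rightarrow> 'x) \<Rightarrow> 'x set \<Rightarrow> 'g set" where
  "set_stabilizer G \<phi> U = {g \<in> carrier G. \<phi> g ` U = U}"

text \<open>\<open>psec F U\<close> is the set \<open>F(U)\<close>, and \<open>pmap F U V g\<close> is the map \<open>F(V) \<rightarrow> F(U)\<close> induced by the
  morphism \<open>g : U \<rightarrow> V\<close>; source and target are arguments because the same group element is a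
  morphism between many pairs of basic sets.\<close>

record ('x, 'g, 'a) presheaf =
  psec :: "'x set \<Rightarrow> 'a set"
  pmap :: "'x set \<Rightarrow> 'x set \<Rightarrow> 'g \<Rightarrow> 'a \<Rightarrow> 'a"

text \<open>The stabilizer of \<open>U\<close> acts on \<open>F(U)\<close> from the left, so \<open>g\<close> acts as \<open>F(g\<inverse>)\<close>.\<close>

definition G_presheaf ::
  "('g, 'm) monoid_scheme \<Rightarrow> 'g topology \<Rightarrow> ('g \<Rightarrow> 'x \<Rightarrow> 'x) \<Rightarrow> 'x set set
     \<Rightarrow> ('x, 'g, 'a) presheaf \<Rightarrow> bool" where
  "G_presheaf G T \<phi> \<B> F \<longleftrightarrow>
     (\<forall>U\<in>\<B>. \<forall>V\<in>\<B>. \<forall>g\<in>orbit_hom G \<phi> U V. pmap F U V g \<in> psec F V \<rightarrow> psec F U) \<and>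
     (\<forall>U\<in>\<B>. \<forall>s\<in>psec F U. pmap F U U \<one>\<^bsub>G\<^esub> s = s) \<and>
     (\<forall>U\<in>\<B>. \<forall>V\<in>\<B>. \<forall>W\<in>\<B>. \<forall>g\<in>orbit_hom G \<phi> U V. \<forall>h\<in>orbit_hom G \<phi> V W. \<forall>s\<in>psec F W.
        pmap F U W (h \<otimes>\<^bsub>G\<^esub> g) s = pmap F U V g (pmap F V W h s)) \<and>
     (\<forall>U\<in>\<B>. continuous_map
        (prod_topology (subtopology T (set_stabilizer G \<phi> U)) (discrete_topology (psec F U)))
        (discrete_topology (psec F U))
        (\<lambda>(g, s). pmap F U U (inv\<^bsub>G\<^esub> g) s))"

text \<open>Morphisms are extensional (undefined outside \<open>\<B>\<close> and \<open>F(U)\<close>), so that equality of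
  morphisms is equality in HOL.\<close>

definition psh_hom ::
  "('g, 'm) monoid_scheme \<Rightarrow> ('g \<Rightarrow> 'x \<Rightarrow> 'x) \<Rightarrow> 'x set set
     \<Rightarrow> ('x, 'g, 'a) presheaf \<Rightarrow> ('x, 'g, 'b) presheaf \<Rightarrow> ('x set \<Rightarrow> 'a \<Rightarrow> 'b) set" where
  "psh_hom G \<phi> \<B> F F' =
     {\<alpha> \<in> (\<Pi>\<^sub>E U\<in>\<B>. psec F U \<rightarrow>\<^sub>E psec F' U).
        \<forall>U\<in>\<B>. \<forall>V\<in>\<B>. \<forall>g\<in>orbit_hom G \<phi> U V. \<forall>s\<in>psec F V.
          \<alpha> U (pmap F U V g s) = pmap F' U V g (\<alpha> V s)}"

definition psh_id ::
  "'x set set \<Rightarrow> ('x, 'g, 'a) presheaf \<Rightarrow> 'x set \<Rightarrow> 'a \<Rightarrow> 'a" where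
  "psh_id \<B> F = (\<lambda>U\<in>\<B>. \<lambda>s\<in>psec F U. s)"

definition psh_comp ::
  "'x set set \<Rightarrow> ('x, 'g, 'a) presheaf \<Rightarrow> ('x set \<Rightarrow> 'b \<Rightarrow> 'c) \<Rightarrow> ('x set \<Rightarrow> 'a \<Rightarrow> 'b)
     \<Rightarrow> 'x set \<Rightarrow> 'a \<Rightarrow> 'c" where
  "psh_comp \<B> F \<beta> \<alpha> = (\<lambda>U\<in>\<B>. compose (psec F U) (\<beta> U) (\<alpha> U))"

definition psh_iso ::
  "('g, 'm) monoid_scheme \<Rightarrow> ('g \<Rightarrow> 'x \<Rightarrow> 'x) \<Rightarrow> 'x set set
     \<Rightarrow> ('x, 'g, 'a) presheaf \<Rightarrow> ('x, 'g, 'b) presheaf \<Rightarrow> ('x set \<Rightarrow> 'a \<Rightarrow> 'b) set" where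
  "psh_iso G \<phi> \<B> F F' =
     {\<alpha> \<in> psh_hom G \<phi> \<B> F F'. \<exists>\<beta>\<in>psh_hom G \<phi> \<B> F' F.
        psh_comp \<B> F \<beta> \<alpha> = psh_id \<B> F \<and> psh_comp \<B> F' \<alpha> \<beta> = psh_id \<B> F'}"


section \<open>\<open>G\<close>-sheaves of sets\<close>

record ('x, 'g, 'e) sheaf =
  total :: "'e topology"
  act :: "'g \<Rightarrow> 'e \<Rightarrow> 'e"
  proj :: "'e \<Rightarrow> 'x"

definition local_homeomorphism :: "'e topology \<Rightarrow> 'x topology \<Rightarrow> ('e \<Rightarrow> 'x) \<Rightarrow> bool" where
  "local_homeomorphism E X p \<longleftrightarrow>
     (\<forall>e\<in>topspace E. \<exists>V. openin E V \<and> e \<in> V \<and> openin X (p ` V) \<and>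
        homeomorphic_map (subtopology E V) (subtopology X (p ` V)) p)"

definition G_sheaf ::
  "('g, 'm) monoid_scheme \<Rightarrow> 'g topology \<Rightarrow> 'x topology \<Rightarrow> ('g \<Rightarrow> 'x \<Rightarrow> 'x)
     \<Rightarrow> ('x, 'g, 'e) sheaf \<Rightarrow> bool" where
  "G_sheaf G T X \<phi> E \<longleftrightarrow>
     G_space G T (total E) (act E) \<and>
     local_homeomorphism (total E) X (proj E) \<and>
     (\<forall>g\<in>carrier G. \<forall>e\<in>topspace (total E). proj E (act E g e) = \<phi> g (proj E e))"

definition sheaf_hom ::
  "('g, 'm) monoid_scheme \<Rightarrow> ('x, 'g, 'd) sheaf \<Rightarrow> ('x, 'g, 'e) sheaf \<Rightarrow> ('d \<Rightarrow> 'e) set" where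
  "sheaf_hom G D E =
     {f \<in> extensional (topspace (total D)).
        continuous_map (total D) (total E) f \<and>
        (\<forall>e\<in>topspace (total D). proj E (f e) = proj D e) \<and>
        (\<forall>g\<in>carrier G. \<forall>e\<in>topspace (total D). f (act D g e) = act E g (f e))}"

definition sheaf_id :: "('x, 'g, 'e) sheaf \<Rightarrow> 'e \<Rightarrow> 'e" where
  "sheaf_id E = (\<lambda>e\<in>topspace (total E). e)"

definition sheaf_comp ::
  "('x, 'g, 'c) sheaf \<Rightarrow> ('d \<Rightarrow> 'e) \<Rightarrow> ('c \<Rightarrow> 'd) \<Rightarrow> 'c \<Rightarrow> 'e" where
  "sheaf_comp C h f = compose (topspace (total C)) h f"

definition sheaf_iso ::
  "('g, 'm) monoid_scheme \<Rightarrow> ('x, 'g, 'd) sheaf \<Rightarrow> ('x, 'g, 'e) sheaf \<Rightarrow> ('d \<Rightarrow> 'e) set" where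
  "sheaf_iso G D E =
     {f \<in> sheaf_hom G D E. \<exists>h\<in>sheaf_hom G E D.
        sheaf_comp D h f = sheaf_id D \<and> sheaf_comp E f h = sheaf_id E}"


section \<open>The forgetful functor\<close>

definition sections :: "'x topology \<Rightarrow> ('x, 'g, 'e) sheaf \<Rightarrow> 'x set \<Rightarrow> ('x \<Rightarrow> 'e) set" where
  "sections X E U =
     {s \<in> extensional U. continuous_map (subtopology X U) (total E) s \<and> (\<forall>x\<in>U. proj E (s x) = x)}"

text \<open>A morphism \<open>g : U \<rightarrow> V\<close> acts by \<open>s \<mapsto> g\<inverse> \<circ> s|\<^bsub>gU\<^esub> \<circ> g\<close>.\<close>

definition forget ::
  "('g, 'm) monoid_scheme \<Rightarrow> 'x topology \<Rightarrow> ('g \<Rightarrow> 'x \<Rightarrow> 'x) \<Rightarrow> ('x, 'g, 'e) sheaf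
     \<Rightarrow> ('x, 'g, 'x \<Rightarrow> 'e) presheaf" where
  "forget G X \<phi> E =
     \<lparr>psec = sections X E,
      pmap = (\<lambda>U V g s. \<lambda>x\<in>U. act E (inv\<^bsub>G\<^esub> g) (s (\<phi> g x)))\<rparr>"

definition forget_map ::
  "'x topology \<Rightarrow> 'x set set \<Rightarrow> ('x, 'g, 'd) sheaf \<Rightarrow> ('d \<Rightarrow> 'e)
     \<Rightarrow> 'x set \<Rightarrow> ('x \<Rightarrow> 'd) \<Rightarrow> ('x \<Rightarrow> 'e)" where
  "forget_map X \<B> D f = (\<lambda>U\<in>\<B>. \<lambda>s\<in>sections X D U. compose U f s)"


section \<open>Equivariant sheafification\<close>

text \<open>The basic neighbourhoods of \<open>x\<close> are directed under reverse inclusion, so the colimit \<open>F\<^sub>x\<close> is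
  the disjoint union of the \<open>F(U)\<close> modulo agreement on a smaller basic neighbourhood. The
  restriction from \<open>U\<close> to \<open>W \<subseteq> U\<close> is induced by the morphism \<open>\<one> : W \<rightarrow> U\<close>.\<close>

definition germ_rel ::
  "('g, 'm) monoid_scheme \<Rightarrow> 'x set set \<Rightarrow> ('x, 'g, 'a) presheaf \<Rightarrow> 'x
     \<Rightarrow> (('x set \<times> 'a) \<times> ('x set \<times> 'a)) set" where
  "germ_rel G \<B> F x =
     {((U, s), (V, t)). U \<in> \<B> \<and> V \<in> \<B> \<and> x \<in> U \<and> x \<in> V \<and> s \<in> psec F U \<and> t \<in> psec F V \<and>
        (\<exists>W\<in>\<B>. x \<in> W \<and> W \<subseteq> U \<inter> V \<and> pmap F W U \<one>\<^bsub>G\<^esub> s = pmap F W V \<one>\<^bsub>G\<^esub> t)}"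

definition stalk ::
  "('g, 'm) monoid_scheme \<Rightarrow> 'x set set \<Rightarrow> ('x, 'g, 'a) presheaf \<Rightarrow> 'x \<Rightarrow> ('x set \<times> 'a) set set" where
  "stalk G \<B> F x = (SIGMA U:{U \<in> \<B>. x \<in> U}. psec F U) // germ_rel G \<B> F x"

type_synonym ('x, 'a) germ = "'x \<times> ('x set \<times> 'a) set"

definition germ ::
  "('g, 'm) monoid_scheme \<Rightarrow> 'x set set \<Rightarrow> ('x, 'g, 'a) presheaf \<Rightarrow> 'x \<Rightarrow> 'x set \<Rightarrow> 'a
     \<Rightarrow> ('x, 'a) germ" where
  "germ G \<B> F x U s = (x, germ_rel G \<B> F x `` {(U, s)})"

definition etale_set ::
  "('g, 'm) monoid_scheme \<Rightarrow> 'x topology \<Rightarrow> 'x set set \<Rightarrow> ('x, 'g, 'a) presheaf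
     \<Rightarrow> ('x, 'a) germ set" where
  "etale_set G X \<B> F = (SIGMA x:topspace X. stalk G \<B> F x)"

definition etale_topology ::
  "('g, 'm) monoid_scheme \<Rightarrow> 'x set set \<Rightarrow> ('x, 'g, 'a) presheaf \<Rightarrow> ('x, 'a) germ topology" where
  "etale_topology G \<B> F =
     topology_generated_by {(\<lambda>x. germ G \<B> F x U s) ` U |U s. U \<in> \<B> \<and> s \<in> psec F U}"

definition sheafify ::
  "('g, 'm) monoid_scheme \<Rightarrow> 'x topology \<Rightarrow> ('g \<Rightarrow> 'x \<Rightarrow> 'x) \<Rightarrow> 'x set set
     \<Rightarrow> ('x, 'g, 'a) presheaf \<Rightarrow> ('x, 'g, ('x, 'a) germ) sheaf" where
  "sheafify G X \<phi> \<B> F =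
     \<lparr>total = etale_topology G \<B> F,
      act = (\<lambda>g. \<lambda>e\<in>etale_set G X \<B> F. THE e'.
        \<exists>U\<in>\<B>. \<exists>s\<in>psec F U. \<exists>x\<in>U. \<exists>V\<in>\<B>.
          e = germ G \<B> F x U s \<and> \<phi> g x \<in> V \<and> V \<subseteq> \<phi> g ` U \<and>
          e' = germ G \<B> F (\<phi> g x) V (pmap F V U (inv\<^bsub>G\<^esub> g) s)),
      proj = fst\<rparr>"

definition sheafify_map ::
  "('g, 'm) monoid_scheme \<Rightarrow> 'x topology \<Rightarrow> 'x set set
     \<Rightarrow> ('x, 'g, 'a) presheaf \<Rightarrow> ('x, 'g, 'b) presheaf \<Rightarrow> ('x set \<Rightarrow> 'a \<Rightarrow> 'b)
     \<Rightarrow> ('x, 'a) germ \<Rightarrow> ('x, 'b) germ" where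
  "sheafify_map G X \<B> F F' \<alpha> =
     (\<lambda>e\<in>etale_set G X \<B> F. THE e'.
        \<exists>U\<in>\<B>. \<exists>s\<in>psec F U. \<exists>x\<in>U. e = germ G \<B> F x U s \<and> e' = germ G \<B> F' x U (\<alpha> U s))"

definition sheafify_unit ::
  "('g, 'm) monoid_scheme \<Rightarrow> 'x set set \<Rightarrow> ('x, 'g, 'a) presheaf
     \<Rightarrow> 'x set \<Rightarrow> 'a \<Rightarrow> ('x \<Rightarrow> ('x, 'a) germ)" where
  "sheafify_unit G \<B> F = (\<lambda>U\<in>\<B>. \<lambda>s\<in>psec F U. \<lambda>x\<in>U. germ G \<B> F x U s)"

text \<open>The adjunction map \<open>Hom(\<ell>F, E) \<rightarrow> Hom(F, \<Gamma>E)\<close>.\<close>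

definition adjunct ::
  "('g, 'm) monoid_scheme \<Rightarrow> 'x topology \<Rightarrow> ('g \<Rightarrow> 'x \<Rightarrow> 'x) \<Rightarrow> 'x set set
     \<Rightarrow> ('x, 'g, 'a) presheaf \<Rightarrow> (('x, 'a) germ \<Rightarrow> 'e) \<Rightarrow> 'x set \<Rightarrow> 'a \<Rightarrow> ('x \<Rightarrow> 'e)" where
  "adjunct G X \<phi> \<B> F f =
     psh_comp \<B> F (forget_map X \<B> (sheafify G X \<phi> \<B> F) f) (sheafify_unit G \<B> F)"

end

theory Submission
  imports Defs
begin

text \<open>A point of \<open>\<ell>F\<close> is a germ \<open>s\<^sub>x\<close>, so a map out of \<open>\<ell>F\<close> is the same thing as a compatible
  prescription \<open>s\<^sub>x \<mapsto> \<alpha>\<^sub>U(s)(x)\<close>; this is the adjunction. Since every section of \<open>\<ell>F\<close> is locally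
  \<open>x \<mapsto> s\<^sub>x\<close> for some \<open>s\<close>, the canonical map sends \<open>\<sigma>(x)\<close> to the germ of \<open>\<sigma>\<close> at \<open>x\<close> for every
  section \<open>\<sigma>\<close> of \<open>\<ell>F\<close>, and its inverse is the counit \<open>\<sigma>\<^sub>x \<mapsto> \<sigma>(x)\<close>. Topology enters through
  compactness of the basic open sets: by the tube lemma, stabilizers of basic open sets and of
  sections over them are open in \<open>G\<close>.\<close>

section \<open>Topological preliminaries\<close>

text \<open>The family \<B> is not assumed stable under intersections or under G. So every
  comparison of germs and every translate of a germ passes to a smaller basic set, and each map
  defined on germs by a definite description must first be shown independent of the representative.
  The two openness results serve continuity in opposite directions. For \<ell>F, all group elements
  near g must translate a representative s of a germ in the same way. The presheaf axiom makes the
  fixer of s open only inside the stabilizer of U, so that stabilizer has to be open in G as well.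
  For a sheaf E, the set of g with gs = t must be open. At one point, agreement of gs and t is an
  open condition because the projection is locally injective; compactness of U yields one
  neighbourhood of g that works at all points. For idempotence, the triangle identity gives only
  that the counit is a left inverse of the canonical map. The other composite is not formal: it
  needs the local description of sections by germs.\<close>

text \<open>The tube lemma in the form used below: an open condition on pairs, imposed at all points
  of a compact set, is open in the parameter.\<close>

lemma openin_forall_compactin:
  assumes N: "openin (prod_topology S Y) N" and K: "compactin Y K"
  shows "openin S {g \<in> topspace S. \<forall>x\<in>K. (g, x) \<in> N}"
proof (subst openin_subopen, intro ballI)
  fix g assume "g \<in> {g \<in> topspace S. \<forall>x\<in>K. (g, x) \<in> N}"
  then have g: "g \<in> topspace S" "{g} \<times> K \<subseteq> N" by auto
  obtain U V where "openin S U" "g \<in> U" "K \<subseteq> V" "U \<times> V \<subseteq> N"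
    using tube_lemma_right[OF N K g] by blast
  then show "\<exists>U. openin S U \<and> g \<in> U \<and> U \<subseteq> {g \<in> topspace S. \<forall>x\<in>K. (g, x) \<in> N}"
    using openin_subset[of S U] by (intro exI[of _ U]) auto
qed

text \<open>With both copies of sections discrete, the preimage of \<open>U\<close> is a union of
  sets \<open>{g. f g s = t} \<times> {s}\<close>, so the continuity axiom of a presheaf becomes
  openness of fibres.\<close>

lemma continuous_map_prod_discreteI:
  assumes mem: "\<And>g s. g \<in> topspace S \<Longrightarrow> s \<in> A \<Longrightarrow> f g s \<in> A'"
    and fibre: "\<And>s t. s \<in> A \<Longrightarrow> t \<in> A' \<Longrightarrow> openin S {g \<in> topspace S. f g s = t}"
  shows "continuous_map (prod_topology S (discrete_topology A)) (discrete_topology A') (\<lambda>(g, s). f g s)"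
  unfolding continuous_map_def
proof (intro conjI allI impI)
  show "(\<lambda>(g, s). f g s) \<in> topspace (prod_topology S (discrete_topology A)) \<rightarrow> topspace (discrete_topology A')"
    using mem by auto
next
  fix U assume "openin (discrete_topology A') U"
  then have U: "U \<subseteq> A'" by simp
  have eq: "{x \<in> topspace (prod_topology S (discrete_topology A)). (case x of (g, s) \<Rightarrow> f g s) \<in> U} =
    (\<Union>s\<in>A. \<Union>t\<in>U. {g \<in> topspace S. f g s = t} \<times> {s})"
    by auto
  show "openin (prod_topology S (discrete_topology A))
      {x \<in> topspace (prod_topology S (discrete_topology A)). (case x of (g, s) \<Rightarrow> f g s) \<in> U}"
    unfolding eq using U fibre by (intro openin_Union) (auto intro!: openin_Union openin_prod_Times_iff[THEN iffD2])
qed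

text \<open>Where the two maps meet, both stay for a while in an open set on which \<open>p\<close>
  is injective; lying over the same point, they then coincide there. It serves both the action on
  sections and the local form of sections of \<ell>F.\<close>

lemma openin_equalizer_local_homeomorphism:
  assumes E: "local_homeomorphism E X p"
    and f: "continuous_map Z E f" and g: "continuous_map Z E g"
    and fg: "\<And>z. z \<in> topspace Z \<Longrightarrow> p (f z) = p (g z)"
  shows "openin Z {z \<in> topspace Z. f z = g z}"
proof (subst openin_subopen, intro ballI)
  fix z assume "z \<in> {z \<in> topspace Z. f z = g z}"
  then have z: "z \<in> topspace Z" "f z = g z" by auto
  have "f z \<in> topspace E" using f z(1) by (auto simp: continuous_map_def)
  then obtain V where V: "openin E V" "f z \<in> V"
      "homeomorphic_map (subtopology E V) (subtopology X (p ` V)) p"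
    using E unfolding local_homeomorphism_def by blast
  have "inj_on p (topspace (subtopology E V))"
    using V(3) by (simp add: homeomorphic_eq_everything_map)
  then have inj: "inj_on p V"
    using openin_subset[OF V(1)] by (simp add: topspace_subtopology Int_absorb1)
  let ?N = "{z \<in> topspace Z. f z \<in> V} \<inter> {z \<in> topspace Z. g z \<in> V}"
  have "openin Z ?N"
    using f g V(1) by (intro openin_Int openin_continuous_map_preimage)
  moreover have "?N \<subseteq> {z \<in> topspace Z. f z = g z}"
    using inj fg by (auto dest: inj_onD)
  ultimately show "\<exists>N. openin Z N \<and> z \<in> N \<and> N \<subseteq> {z \<in> topspace Z. f z = g z}"
    using z V(2) by (intro exI[of _ ?N]) auto
qed

section \<open>Group actions\<close>

text \<open>\<open>group_action\<close> asks for a homomorphism into \<open>BijGroup E\<close>,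
  whose elements are extensional bijections. Bijectivity comes for free from the action of
  \<open>inv g\<close>; extensionality has to be supplied.\<close>

lemma group_actionI:
  fixes G (structure)
  assumes "group G"
    and ext: "\<And>g. g \<in> carrier G \<Longrightarrow> \<psi> g \<in> extensional E"
    and closed: "\<And>g x. g \<in> carrier G \<Longrightarrow> x \<in> E \<Longrightarrow> \<psi> g x \<in> E"
    and one: "\<And>x. x \<in> E \<Longrightarrow> \<psi> \<one> x = x"
    and mult: "\<And>g h x. g \<in> carrier G \<Longrightarrow> h \<in> carrier G \<Longrightarrow> x \<in> E \<Longrightarrow> \<psi> (g \<otimes> h) x = \<psi> g (\<psi> h x)"
  shows "group_action G E \<psi>"
proof -
  interpret group G by fact
  have inv1: "\<psi> (inv g) (\<psi> g x) = x" "\<psi> g (\<psi> (inv g) x) = x" if "g \<in> carrier G" "x \<in> E" for g x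
    using that mult[of "inv g" g x] mult[of g "inv g" x] one by auto
  have "bij_betw (\<psi> g) E E" if "g \<in> carrier G" for g
    using that closed inv1 by (intro bij_betwI[of _ _ _ "\<psi> (inv g)"]) auto
  then have bij: "\<psi> g \<in> Bij E" if "g \<in> carrier G" for g
    using that ext by (simp add: Bij_def)
  have "\<psi> (g \<otimes> h) = compose E (\<psi> g) (\<psi> h)" if "g \<in> carrier G" "h \<in> carrier G" for g h
  proof (rule extensionalityI)
    show "\<psi> (g \<otimes> h) \<in> extensional E" using that ext by simp
  qed (use that mult in \<open>auto simp: compose_eq\<close>)
  then have "\<psi> \<in> hom G (BijGroup E)"
    using bij by (auto simp: hom_def BijGroup_def)
  then show ?thesis
    by (simp add: group_action_def group_hom_def group_hom_axioms_def assms(1) group_BijGroup)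
qed

context
  fixes G (structure) and T X \<psi>
  assumes GX: "G_space G T X \<psi>"
begin

lemma G_space_group: "group G"
  using GX by (auto simp: G_space_def group_action_def group_hom_def)

lemma G_space_closed: "g \<in> carrier G \<Longrightarrow> x \<in> topspace X \<Longrightarrow> \<psi> g x \<in> topspace X"
  using GX group_action.element_image by (fastforce simp: G_space_def)

lemma G_space_one: "x \<in> topspace X \<Longrightarrow> \<psi> \<one> x = x"
  using GX group_action.id_eq_one unfolding G_space_def by (metis restrict_apply')

lemma G_space_mult:
  "g \<in> carrier G \<Longrightarrow> h \<in> carrier G \<Longrightarrow> x \<in> topspace X \<Longrightarrow> \<psi> (g \<otimes> h) x = \<psi> g (\<psi> h x)"
  using GX group_action.composition_rule by (fastforce simp: G_space_def)

lemma G_space_inv: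
  assumes "g \<in> carrier G" "x \<in> topspace X"
  shows "\<psi> (inv g) (\<psi> g x) = x" "\<psi> g (\<psi> (inv g) x) = x"
proof -
  interpret group G by (rule G_space_group)
  show "\<psi> (inv g) (\<psi> g x) = x" "\<psi> g (\<psi> (inv g) x) = x"
    using G_space_mult[of "inv g" g x] G_space_mult[of g "inv g" x] assms G_space_one by auto
qed

lemma G_space_continuous_map:
  assumes "continuous_map Z T a" "continuous_map Z X b"
  shows "continuous_map Z X (\<lambda>z. \<psi> (a z) (b z))"
proof -
  have "continuous_map Z (prod_topology T X) (\<lambda>z. (a z, b z))"
    using assms by (simp add: continuous_map_paired)
  moreover have "continuous_map (prod_topology T X) X (\<lambda>(g, x). \<psi> g x)"
    using GX by (simp add: G_space_def)
  ultimately show ?thesis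
    using continuous_map_compose by (fastforce simp: o_def)
qed

text \<open>The action on germs is specified by V \<subseteq> gU, whereas presheaf morphisms are
  specified by inv g mapping V into U. This lemma and the next translate between the two.\<close>

lemma G_space_image_inv_subset:
  assumes "g \<in> carrier G" "U \<subseteq> topspace X" "V \<subseteq> \<psi> g ` U"
  shows "\<psi> (inv g) ` V \<subseteq> U"
  using assms G_space_inv by fastforce

lemma G_space_subset_image:
  assumes "g \<in> carrier G" "V \<subseteq> topspace X" "\<psi> (inv g) ` V \<subseteq> U"
  shows "V \<subseteq> \<psi> g ` U"
proof
  fix x assume "x \<in> V"
  then have "x = \<psi> g (\<psi> (inv g) x)" "\<psi> (inv g) x \<in> U" using assms G_space_inv by auto
  then show "x \<in> \<psi> g ` U" by blast
qed

end

section \<open>Presheaves over a basis and their germs\<close>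

locale G_basis =
  fixes G :: "('g, 'm) monoid_scheme" (structure) and T :: "'g topology"
    and X :: "'x topology" and \<phi> :: "'g \<Rightarrow> 'x \<Rightarrow> 'x" and \<B> :: "'x set set"
  assumes topological_group: "topological_group G T"
    and compact: "compact_space X"
    and G_space: "G_space G T X \<phi>"
    and basis: "open_closed_basis X \<B>"
begin

abbreviation psh where "psh F \<equiv> G_presheaf G T \<phi> \<B> F"
abbreviation shf where "shf E \<equiv> G_sheaf G T X \<phi> E"
abbreviation gm where "gm F \<equiv> germ G \<B> F"
abbreviation etale where "etale F \<equiv> etale_topology G \<B> F"
abbreviation \<Gamma> where "\<Gamma> E \<equiv> forget G X \<phi> E"
abbreviation \<L> where "\<L> F \<equiv> sheafify G X \<phi> \<B> F"

sublocale group G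
  using topological_group by (simp add: topological_group_def)

section \<open>Translates of basic sets and openness of their stabilizers\<close>

lemma topspace_T: "topspace T = carrier G"
  using topological_group by (simp add: topological_group_def)

lemma continuous_map_inv: "continuous_map T T (\<lambda>g. inv g)"
  using topological_group by (simp add: topological_group_def)

lemma continuous_map_translate:
  assumes "g \<in> carrier G"
  shows "continuous_map T T (\<lambda>h. g \<otimes> h)"
proof -
  have "continuous_map T (prod_topology T T) (\<lambda>h. (g, h))"
    using assms by (simp add: continuous_map_paired topspace_T)
  moreover have "continuous_map (prod_topology T T) T (\<lambda>(g, h). g \<otimes> h)"
    using topological_group by (simp add: topological_group_def)
  ultimately show ?thesis
    using continuous_map_compose by (fastforce simp: o_def)
qed

lemmas \<phi>_closed = G_space_closed[OF G_space]
lemmas \<phi>_one = G_space_one[OF G_space]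
lemmas \<phi>_mult = G_space_mult[OF G_space]
lemmas \<phi>_inv = G_space_inv[OF G_space]

lemma continuous_map_\<phi>: "g \<in> carrier G \<Longrightarrow> continuous_map X X (\<phi> g)"
  using G_space_continuous_map[OF G_space, of X "\<lambda>_. g" "\<lambda>x. x"] by (simp add: topspace_T)

lemma basis_open: "U \<in> \<B> \<Longrightarrow> openin X U"
  using basis by (simp add: open_closed_basis_def)

lemma basis_subset: "U \<in> \<B> \<Longrightarrow> U \<subseteq> topspace X"
  using basis_open openin_subset by blast

lemma basis_mem: "U \<in> \<B> \<Longrightarrow> x \<in> U \<Longrightarrow> x \<in> topspace X"
  using basis_subset by blast

lemma basis_compact: "U \<in> \<B> \<Longrightarrow> compactin X U"
  using basis compact by (simp add: open_closed_basis_def closedin_compact_space)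

lemma basis_refine:
  assumes "openin X W" "x \<in> W"
  obtains U where "U \<in> \<B>" "x \<in> U" "U \<subseteq> W"
  using basis assms unfolding open_closed_basis_def by metis

lemma openin_translate:
  assumes "g \<in> carrier G" "openin X U"
  shows "openin X (\<phi> g ` U)"
proof -
  have "\<phi> g ` U = {x \<in> topspace X. \<phi> (inv g) x \<in> U}"
    using assms openin_subset[OF assms(2)] \<phi>_inv \<phi>_closed by (force simp: image_iff)
  then show ?thesis
    using openin_continuous_map_preimage[OF continuous_map_\<phi>[of "inv g"] assms(2)] assms(1) by simp
qed

lemma translate_one: "U \<in> \<B> \<Longrightarrow> \<phi> \<one> ` U = U"
  using \<phi>_one basis_subset by force

text \<open>The translate gU is open but may fail to lie in \<B>; a basic set inside it is the
  substitute, and this is the extra choice in the action on germs.\<close>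

lemma basis_refine_translate:
  assumes "U \<in> \<B>" "x \<in> U" "g \<in> carrier G"
  obtains V where "V \<in> \<B>" "\<phi> g x \<in> V" "V \<subseteq> \<phi> g ` U"
  using basis_refine[OF openin_translate[OF assms(3) basis_open[OF assms(1)]]] assms(2) by blast

lemma stabilizer_inv_subset:
  assumes "g \<in> set_stabilizer G \<phi> U" "U \<subseteq> topspace X"
  shows "\<phi> (inv g) ` U \<subseteq> U"
  using G_space_image_inv_subset[OF G_space _ assms(2)] assms(1) by (simp add: set_stabilizer_def)

text \<open>Mapping U into itself is an open condition on g, because U is closed in a compact space
  and hence compact. Equality gU = U is this condition for both g and \<open>inv g\<close>, and
  inversion is continuous.\<close>

lemma openin_stabilizer:
  assumes "U \<in> \<B>"
  shows "openin T (set_stabilizer G \<phi> U)"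
proof -
  let ?N = "{z \<in> topspace (prod_topology T X). \<phi> (fst z) (snd z) \<in> U}"
  let ?S = "{g \<in> topspace T. \<forall>x\<in>U. (g, x) \<in> ?N}"
  have "continuous_map (prod_topology T X) X (\<lambda>z. \<phi> (fst z) (snd z))"
    by (intro G_space_continuous_map[OF G_space] continuous_map_fst continuous_map_snd)
  then have "openin (prod_topology T X) ?N"
    using basis_open[OF assms] by (rule openin_continuous_map_preimage)
  then have S: "openin T ?S"
    using basis_compact[OF assms] by (rule openin_forall_compactin)
  have mem: "g \<in> ?S \<longleftrightarrow> g \<in> carrier G \<and> \<phi> g ` U \<subseteq> U" for g
    using basis_subset[OF assms] by (auto simp: topspace_T)
  have "set_stabilizer G \<phi> U = ?S \<inter> {g \<in> topspace T. inv g \<in> ?S}"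
  proof (rule Set.set_eqI)
    fix g
    have "\<phi> g ` U = U \<longleftrightarrow> \<phi> g ` U \<subseteq> U \<and> \<phi> (inv g) ` U \<subseteq> U" if "g \<in> carrier G"
      using G_space_image_inv_subset[OF G_space that basis_subset[OF assms], of U]
        G_space_subset_image[OF G_space that basis_subset[OF assms], of U] by blast
    then show "g \<in> set_stabilizer G \<phi> U \<longleftrightarrow> g \<in> ?S \<inter> {g \<in> topspace T. inv g \<in> ?S}"
      unfolding Int_iff mem by (auto simp: set_stabilizer_def topspace_T mem)
  qed
  then show ?thesis
    using openin_Int[OF S openin_continuous_map_preimage[OF continuous_map_inv S]] by simp
qed

section \<open>Functoriality of a presheaf and restriction maps\<close>

lemma pmap_closed:
  "psh F \<Longrightarrow> U \<in> \<B> \<Longrightarrow> V \<in> \<B> \<Longrightarrow> g \<in> carrier G \<Longrightarrow> \<phi> g ` U \<subseteq> V \<Longrightarrow> s \<in> psec F V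
    \<Longrightarrow> pmap F U V g s \<in> psec F U"
  unfolding G_presheaf_def orbit_hom_def by blast

lemma pmap_one: "psh F \<Longrightarrow> U \<in> \<B> \<Longrightarrow> s \<in> psec F U \<Longrightarrow> pmap F U U \<one> s = s"
  unfolding G_presheaf_def by blast

lemma pmap_pmap:
  assumes "psh F" "U \<in> \<B>" "V \<in> \<B>" "W \<in> \<B>" "g \<in> carrier G" "\<phi> g ` U \<subseteq> V"
    "h \<in> carrier G" "\<phi> h ` V \<subseteq> W" "s \<in> psec F W"
  shows "pmap F U V g (pmap F V W h s) = pmap F U W (h \<otimes> g) s"
proof -
  have "g \<in> orbit_hom G \<phi> U V" "h \<in> orbit_hom G \<phi> V W"
    using assms by (auto simp: orbit_hom_def)
  then show ?thesis
    using assms(1-4,9) unfolding G_presheaf_def by metis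
qed

text \<open>Continuity into a discrete set makes the fixer of s open in the stabilizer of U;
  openness of that stabilizer carries this over to \<open>T\<close>.\<close>

lemma openin_section_stabilizer:
  assumes F: "psh F" and U: "U \<in> \<B>" and s: "s \<in> psec F U"
  shows "openin T {h \<in> set_stabilizer G \<phi> U. pmap F U U (inv h) s = s}"
proof -
  let ?S = "subtopology T (set_stabilizer G \<phi> U)"
  have "continuous_map ?S (prod_topology ?S (discrete_topology (psec F U))) (\<lambda>h. (h, s))"
    using s by (simp add: continuous_map_paired)
  moreover have "continuous_map (prod_topology ?S (discrete_topology (psec F U)))
      (discrete_topology (psec F U)) (\<lambda>(g, s). pmap F U U (inv g) s)"
    using F U unfolding G_presheaf_def by blast
  ultimately have "continuous_map ?S (discrete_topology (psec F U)) (\<lambda>h. pmap F U U (inv h) s)"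
    using continuous_map_compose by (fastforce simp: o_def)
  then have "openin ?S {h \<in> topspace ?S. pmap F U U (inv h) s \<in> {s}}"
    by (rule openin_continuous_map_preimage) (use s in simp)
  moreover have top: "topspace ?S = set_stabilizer G \<phi> U"
    by (auto simp: topspace_T set_stabilizer_def)
  ultimately show ?thesis
    unfolding top openin_open_subtopology[OF openin_stabilizer[OF U]] by simp
qed

lemma restriction_closed:
  "psh F \<Longrightarrow> W \<in> \<B> \<Longrightarrow> U \<in> \<B> \<Longrightarrow> W \<subseteq> U \<Longrightarrow> s \<in> psec F U \<Longrightarrow> pmap F W U \<one> s \<in> psec F W"
  by (rule pmap_closed) (auto simp: translate_one)

lemma restriction_pmap:
  "psh F \<Longrightarrow> W \<in> \<B> \<Longrightarrow> V \<in> \<B> \<Longrightarrow> U \<in> \<B> \<Longrightarrow> W \<subseteq> V \<Longrightarrow> g \<in> carrier G \<Longrightarrow> \<phi> g ` V \<subseteq> U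
    \<Longrightarrow> s \<in> psec F U \<Longrightarrow> pmap F W V \<one> (pmap F V U g s) = pmap F W U g s"
  by (subst pmap_pmap) (auto simp: translate_one)

lemma pmap_restriction:
  "psh F \<Longrightarrow> W \<in> \<B> \<Longrightarrow> V \<in> \<B> \<Longrightarrow> U \<in> \<B> \<Longrightarrow> V \<subseteq> U \<Longrightarrow> g \<in> carrier G \<Longrightarrow> \<phi> g ` W \<subseteq> V
    \<Longrightarrow> s \<in> psec F U \<Longrightarrow> pmap F W V g (pmap F V U \<one> s) = pmap F W U g s"
  by (subst pmap_pmap) (auto simp: translate_one)

lemma restriction_restriction:
  "psh F \<Longrightarrow> W \<in> \<B> \<Longrightarrow> V \<in> \<B> \<Longrightarrow> U \<in> \<B> \<Longrightarrow> W \<subseteq> V \<Longrightarrow> V \<subseteq> U \<Longrightarrow> s \<in> psec F U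
    \<Longrightarrow> pmap F W V \<one> (pmap F V U \<one> s) = pmap F W U \<one> s"
  by (subst restriction_pmap) (auto simp: translate_one)

section \<open>Germs as equivalence classes\<close>

text \<open>Only transitivity needs an idea: the two witnessing sets are refined to a basic
  \<open>R\<close> inside their intersection, and both equalities are restricted to
  \<open>R\<close>.\<close>

lemma equiv_germ_rel:
  assumes F: "psh F"
  shows "equiv (SIGMA U:{U \<in> \<B>. x \<in> U}. psec F U) (germ_rel G \<B> F x)"
proof (rule equivI)
  show "germ_rel G \<B> F x \<subseteq> (SIGMA U:{U \<in> \<B>. x \<in> U}. psec F U) \<times> (SIGMA U:{U \<in> \<B>. x \<in> U}. psec F U)"
    by (auto simp: germ_rel_def)
  show "refl_on (SIGMA U:{U \<in> \<B>. x \<in> U}. psec F U) (germ_rel G \<B> F x)"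
    by (rule refl_onI) (auto simp: germ_rel_def)
  show "sym (germ_rel G \<B> F x)"
  proof (rule symI, clarify)
    fix U s V t
    assume "((U, s), (V, t)) \<in> germ_rel G \<B> F x"
    then show "((V, t), (U, s)) \<in> germ_rel G \<B> F x"
      unfolding germ_rel_def mem_Collect_eq prod.case by (metis Int_commute)
  qed
  show "trans (germ_rel G \<B> F x)"
  proof (rule transI)
    fix a b c
    assume ab: "(a, b) \<in> germ_rel G \<B> F x" and bc: "(b, c) \<in> germ_rel G \<B> F x"
    obtain U s V t W u where abc: "a = (U, s)" "b = (V, t)" "c = (W, u)"
      by (metis surj_pair)
    obtain P Q where B: "U \<in> \<B>" "V \<in> \<B>" "W \<in> \<B>" "P \<in> \<B>" "Q \<in> \<B>"
      and x: "x \<in> U" "x \<in> W" "x \<in> P" "x \<in> Q" and sec: "s \<in> psec F U" "t \<in> psec F V" "u \<in> psec F W"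
      and sub: "P \<subseteq> U" "P \<subseteq> V" "Q \<subseteq> V" "Q \<subseteq> W"
      and eq: "pmap F P U \<one> s = pmap F P V \<one> t" "pmap F Q V \<one> t = pmap F Q W \<one> u"
      using ab bc unfolding abc germ_rel_def by blast
    obtain R where R: "R \<in> \<B>" "x \<in> R" "R \<subseteq> P \<inter> Q"
      using basis_refine[of "P \<inter> Q" x] B x basis_open by blast
    have "pmap F R U \<one> s = pmap F R P \<one> (pmap F P U \<one> s)"
      using restriction_restriction[OF F] B R sub sec by auto
    also have "\<dots> = pmap F R V \<one> t"
      using restriction_restriction[OF F] B R sub sec by (auto simp: eq)
    also have "\<dots> = pmap F R Q \<one> (pmap F Q V \<one> t)"
      using restriction_restriction[OF F] B R sub sec by auto
    also have "\<dots> = pmap F R W \<one> u"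
      using restriction_restriction[OF F] B R sub sec by (auto simp: eq)
    finally have "pmap F R U \<one> s = pmap F R W \<one> u" .
    moreover have "R \<subseteq> U \<inter> W" using R sub by blast
    ultimately show "(a, c) \<in> germ_rel G \<B> F x"
      unfolding abc germ_rel_def mem_Collect_eq prod.case using B R x sec by metis
  qed
qed

lemma fst_germ [simp]: "fst (gm F x U s) = x"
  by (simp add: germ_def)

text \<open>A germ carries its base point as first component, so equal germs have equal base points;
  over a fixed point, equality of classes is the germ relation.\<close>

lemma germ_eq_iff:
  assumes F: "psh F" and "U \<in> \<B>" "V \<in> \<B>" "x \<in> U" "y \<in> V" "s \<in> psec F U" "t \<in> psec F V"
  shows "gm F x U s = gm F y V t \<longleftrightarrow>
    x = y \<and> (\<exists>W\<in>\<B>. x \<in> W \<and> W \<subseteq> U \<inter> V \<and> pmap F W U \<one> s = pmap F W V \<one> t)"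
proof (cases "x = y")
  case True
  then have "gm F x U s = gm F y V t \<longleftrightarrow> ((U, s), (V, t)) \<in> germ_rel G \<B> F x"
    unfolding germ_def using eq_equiv_class_iff[OF equiv_germ_rel[OF F, of x]] assms by auto
  then show ?thesis using True assms by (auto simp: germ_rel_def)
qed (simp add: germ_def)

lemma germ_restriction:
  assumes F: "psh F" and "U \<in> \<B>" "W \<in> \<B>" "W \<subseteq> U" "x \<in> W" "s \<in> psec F U"
  shows "gm F x W (pmap F W U \<one> s) = gm F x U s"
proof -
  have "pmap F W W \<one> (pmap F W U \<one> s) = pmap F W U \<one> s"
    using assms by (intro pmap_one restriction_closed) auto
  then show ?thesis
    using assms by (subst germ_eq_iff) (auto intro!: restriction_closed bexI[of _ W])
qed

lemma germ_mem_etale: "U \<in> \<B> \<Longrightarrow> x \<in> U \<Longrightarrow> s \<in> psec F U \<Longrightarrow> gm F x U s \<in> etale_set G X \<B> F"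
  by (auto simp: etale_set_def germ_def stalk_def basis_mem intro!: quotientI)

lemma etale_setE:
  assumes "e \<in> etale_set G X \<B> F"
  obtains U s x where "U \<in> \<B>" "x \<in> U" "s \<in> psec F U" "e = gm F x U s"
  using assms by (auto simp: etale_set_def germ_def stalk_def elim!: quotientE)

lemma topspace_etale: "topspace (etale F) = etale_set G X \<B> F"
  unfolding etale_topology_def topology_generated_by_topspace
  by (auto intro: germ_mem_etale elim!: etale_setE)

text \<open>A value invariant under restriction depends only on the germ, since two representatives
  become equal on some common \<open>W\<close>. It evaluates the definite descriptions of the
  transpose and of \<open>sheafify_map\<close>. The action involves the further choice of V and is
  treated separately.\<close>

lemma the_germ_value:
  assumes F: "psh F"
    and K: "\<And>W U x s. W \<in> \<B> \<Longrightarrow> U \<in> \<B> \<Longrightarrow> W \<subseteq> U \<Longrightarrow> x \<in> W \<Longrightarrow> s \<in> psec F U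
      \<Longrightarrow> K x W (pmap F W U \<one> s) = K x U s"
    and U: "U \<in> \<B>" "x \<in> U" "s \<in> psec F U"
  shows "(THE e'. \<exists>V\<in>\<B>. \<exists>t\<in>psec F V. \<exists>y\<in>V. gm F x U s = gm F y V t \<and> e' = K y V t) = K x U s"
proof (rule the_equality)
  show "\<exists>V\<in>\<B>. \<exists>t\<in>psec F V. \<exists>y\<in>V. gm F x U s = gm F y V t \<and> K x U s = K y V t"
    using U by blast
next
  fix e' assume "\<exists>V\<in>\<B>. \<exists>t\<in>psec F V. \<exists>y\<in>V. gm F x U s = gm F y V t \<and> e' = K y V t"
  then obtain V t y where V: "V \<in> \<B>" "y \<in> V" "t \<in> psec F V" "gm F x U s = gm F y V t" "e' = K y V t"
    by blast
  then obtain W where W: "x = y" "W \<in> \<B>" "x \<in> W" "W \<subseteq> U" "W \<subseteq> V" "pmap F W U \<one> s = pmap F W V \<one> t"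
    using germ_eq_iff[OF F] U by auto
  have "K x U s = K x W (pmap F W U \<one> s)"
    by (rule K[symmetric]) (use W U in auto)
  also have "\<dots> = K y V t"
    unfolding W(6) W(1)[symmetric] by (rule K) (use W V in auto)
  finally show "e' = K x U s" using V by simp
qed

lemma etale_set_extensionalityI:
  assumes "f \<in> extensional (etale_set G X \<B> F)" "h \<in> extensional (etale_set G X \<B> F)"
    and "\<And>U x s. U \<in> \<B> \<Longrightarrow> x \<in> U \<Longrightarrow> s \<in> psec F U \<Longrightarrow> f (gm F x U s) = h (gm F x U s)"
  shows "f = h"
  using assms by (intro extensionalityI[of f]) (auto elim!: etale_setE)

section \<open>The sheaf of germs\<close>

lemma openin_germs:
  "U \<in> \<B> \<Longrightarrow> s \<in> psec F U \<Longrightarrow> openin (etale F) ((\<lambda>x. gm F x U s) ` U)"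
  unfolding etale_topology_def by (rule topology_generated_by_Basis) blast

text \<open>Equality of germs spreads: the \<open>W\<close> witnessing it at one point witnesses it
  at each of its points. Checking preimages of the generating sets suffices, so these need not be
  shown to form a basis.\<close>

lemma continuous_map_germ:
  assumes F: "psh F" and U: "U \<in> \<B>" "s \<in> psec F U"
  shows "continuous_map (subtopology X U) (etale F) (\<lambda>x. gm F x U s)"
  unfolding etale_topology_def
proof (rule continuous_on_generated_topo)
  have top: "topspace (subtopology X U) = U" using basis_subset[OF U(1)] by auto
  show "(\<lambda>x. gm F x U s) ` topspace (subtopology X U) \<subseteq>
      \<Union> {(\<lambda>x. gm F x U s) ` U |U s. U \<in> \<B> \<and> s \<in> psec F U}"
    unfolding top using U by blast
  fix A assume "A \<in> {(\<lambda>x. gm F x U s) ` U |U s. U \<in> \<B> \<and> s \<in> psec F U}"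
  then obtain V t where V: "V \<in> \<B>" "t \<in> psec F V" "A = (\<lambda>x. gm F x V t) ` V" by blast
  have "openin X ((\<lambda>x. gm F x U s) -` A \<inter> U)"
  proof (subst openin_subopen, intro ballI)
    fix x assume "x \<in> (\<lambda>x. gm F x U s) -` A \<inter> U"
    then obtain W where W: "W \<in> \<B>" "x \<in> W" "W \<subseteq> U \<inter> V" "pmap F W U \<one> s = pmap F W V \<one> t"
      using V U by (auto simp: germ_eq_iff[OF F])
    have "gm F z U s = gm F z V t" if "z \<in> W" for z
      using that W U V by (subst germ_eq_iff[OF F]) auto
    then have "W \<subseteq> (\<lambda>x. gm F x U s) -` A \<inter> U"
      using W V by auto
    then show "\<exists>W. openin X W \<and> x \<in> W \<and> W \<subseteq> (\<lambda>x. gm F x U s) -` A \<inter> U"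
      using W basis_open by blast
  qed
  then show "openin (subtopology X U) ((\<lambda>x. gm F x U s) -` A \<inter> topspace (subtopology X U))"
    unfolding top by (simp add: openin_open_subtopology[OF basis_open[OF U(1)]])
qed

text \<open>The topology on \<ell>F is final for the germ sections, so continuity out of \<ell>F can
  be tested on one representative at a time.\<close>

lemma continuous_map_from_etale:
  assumes F: "psh F"
    and f: "\<And>U s. U \<in> \<B> \<Longrightarrow> s \<in> psec F U \<Longrightarrow> continuous_map (subtopology X U) Y (\<lambda>x. f (gm F x U s))"
  shows "continuous_map (etale F) Y f"
  unfolding continuous_map_def topspace_etale
proof (intro conjI allI impI)
  have top: "topspace (subtopology X U) = U" if "U \<in> \<B>" for U using basis_subset[OF that] by auto
  show "f \<in> etale_set G X \<B> F \<rightarrow> topspace Y"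
  proof
    fix e assume "e \<in> etale_set G X \<B> F"
    then obtain U s x where U: "U \<in> \<B>" "x \<in> U" "s \<in> psec F U" "e = gm F x U s" by (rule etale_setE)
    then show "f e \<in> topspace Y"
      using f[of U s] top by (auto simp: continuous_map_def)
  qed
  fix N assume N: "openin Y N"
  show "openin (etale F) {e \<in> etale_set G X \<B> F. f e \<in> N}"
  proof (subst openin_subopen, intro ballI)
    fix e assume "e \<in> {e \<in> etale_set G X \<B> F. f e \<in> N}"
    then obtain U s x where U: "U \<in> \<B>" "x \<in> U" "s \<in> psec F U" "e = gm F x U s" and e: "f e \<in> N"
      by (auto elim: etale_setE)
    have "openin (subtopology X U) {z \<in> topspace (subtopology X U). f (gm F z U s) \<in> N}"
      using f[OF U(1,3)] N by (rule openin_continuous_map_preimage)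
    then have "openin X {z \<in> U. f (gm F z U s) \<in> N}"
      unfolding top[OF U(1)] openin_open_subtopology[OF basis_open[OF U(1)]] by simp
    then obtain W where W: "W \<in> \<B>" "x \<in> W" "W \<subseteq> {z \<in> U. f (gm F z U s) \<in> N}"
      by (rule basis_refine) (use U e in auto)
    \<comment> \<open>Restricting s to \<open>W\<close> turns the neighbourhood of e into a
      generating open set, while the germs over \<open>W\<close> stay the same.\<close>
    define t where "t = pmap F W U \<one> s"
    have t: "t \<in> psec F W" unfolding t_def using F U W by (intro restriction_closed) auto
    have germ_t: "gm F z W t = gm F z U s" if "z \<in> W" for z
      unfolding t_def using F U W that by (intro germ_restriction) auto
    have "(\<lambda>z. gm F z W t) ` W \<subseteq> {e \<in> etale_set G X \<B> F. f e \<in> N}"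
      using germ_t W U by (auto intro!: germ_mem_etale)
    then show "\<exists>P. openin (etale F) P \<and> e \<in> P \<and> P \<subseteq> {e \<in> etale_set G X \<B> F. f e \<in> N}"
      using openin_germs[OF W(1) t] germ_t W U by (intro exI[of _ "(\<lambda>z. gm F z W t) ` W"]) auto
  qed
qed

lemma continuous_map_fst_etale: "psh F \<Longrightarrow> continuous_map (etale F) X fst"
  by (rule continuous_map_from_etale) (auto simp: continuous_map_from_subtopology)

text \<open>On the open set of all germs of a fixed s, the projection has the germ section as its
  continuous inverse.\<close>

lemma local_homeomorphism_etale:
  assumes F: "psh F"
  shows "local_homeomorphism (etale F) X fst"
  unfolding local_homeomorphism_def topspace_etale
proof
  fix e assume "e \<in> etale_set G X \<B> F"
  then obtain U s x where U: "U \<in> \<B>" "x \<in> U" "s \<in> psec F U" "e = gm F x U s" by (rule etale_setE)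
  let ?V = "(\<lambda>x. gm F x U s) ` U"
  have img: "fst ` ?V = U" by (auto simp: image_image)
  have V: "openin (etale F) ?V" by (intro openin_germs U)
  have "continuous_map (subtopology (etale F) ?V) (subtopology X U) fst"
    by (auto simp: continuous_map_in_subtopology continuous_map_from_subtopology continuous_map_fst_etale[OF F])
  moreover have "continuous_map (subtopology X U) (subtopology (etale F) ?V) (\<lambda>x. gm F x U s)"
    by (auto simp: continuous_map_in_subtopology continuous_map_germ[OF F U(1,3)])
  ultimately have "homeomorphic_maps (subtopology (etale F) ?V) (subtopology X U) fst (\<lambda>x. gm F x U s)"
    by (auto simp: homeomorphic_maps_def)
  then have "homeomorphic_map (subtopology (etale F) ?V) (subtopology X U) fst"
    by (auto simp: homeomorphic_map_maps)
  then show "\<exists>V. openin (etale F) V \<and> e \<in> V \<and> openin X (fst ` V) \<and>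
      homeomorphic_map (subtopology (etale F) V) (subtopology X (fst ` V)) fst"
    using V U basis_open by (intro exI[of _ ?V]) (auto simp: img)
qed

section \<open>The group action on germs\<close>

text \<open>Independence of both choices, the representative and the target set. On a basic
  \<open>P\<close> inside V, V' and the translate of \<open>W\<close>, either result is the pullback
  along \<open>inv g\<close> of the common restriction of s and s' to \<open>W\<close>.\<close>

lemma germ_translate_unique:
  assumes F: "psh F" and g: "g \<in> carrier G"
    and U: "U \<in> \<B>" "x \<in> U" "s \<in> psec F U" and V: "V \<in> \<B>" "\<phi> g x \<in> V" "V \<subseteq> \<phi> g ` U"
    and U': "U' \<in> \<B>" "x' \<in> U'" "s' \<in> psec F U'" and V': "V' \<in> \<B>" "\<phi> g x' \<in> V'" "V' \<subseteq> \<phi> g ` U'"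
    and eq: "gm F x U s = gm F x' U' s'"
  shows "gm F (\<phi> g x) V (pmap F V U (inv g) s) = gm F (\<phi> g x') V' (pmap F V' U' (inv g) s')"
proof -
  obtain W where W: "x = x'" "W \<in> \<B>" "x \<in> W" "W \<subseteq> U" "W \<subseteq> U'" "pmap F W U \<one> s = pmap F W U' \<one> s'"
    using eq U U' by (auto simp: germ_eq_iff[OF F])
  have ig: "inv g \<in> carrier G" using g by simp
  have "openin X (V \<inter> V' \<inter> \<phi> g ` W)"
    using V V' W g by (intro openin_Int basis_open openin_translate)
  then obtain P where P: "P \<in> \<B>" "\<phi> g x \<in> P" "P \<subseteq> V \<inter> V' \<inter> \<phi> g ` W"
    by (rule basis_refine) (use V V' W in auto)
  have sub: "\<phi> (inv g) ` V \<subseteq> U" "\<phi> (inv g) ` V' \<subseteq> U'" "\<phi> (inv g) ` P \<subseteq> W"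
    using G_space_image_inv_subset[OF G_space g] basis_subset U U' V V' W P by auto
  have "pmap F P V \<one> (pmap F V U (inv g) s) = pmap F P U (inv g) s"
    using F P V U sub ig by (intro restriction_pmap) auto
  also have "\<dots> = pmap F P W (inv g) (pmap F W U \<one> s)"
    using F P W U sub ig by (intro pmap_restriction[symmetric]) auto
  also have "\<dots> = pmap F P U' (inv g) s'"
    unfolding W(6) using F P W U' sub ig by (intro pmap_restriction) auto
  also have "\<dots> = pmap F P V' \<one> (pmap F V' U' (inv g) s')"
    using F P V' U' sub ig by (intro restriction_pmap[symmetric]) auto
  finally have eqP: "pmap F P V \<one> (pmap F V U (inv g) s) = pmap F P V' \<one> (pmap F V' U' (inv g) s')" .
  have "pmap F V U (inv g) s \<in> psec F V" "pmap F V' U' (inv g) s' \<in> psec F V'"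
    using F U U' V V' sub ig by (auto intro: pmap_closed)
  moreover have "P \<subseteq> V \<inter> V'" using P by blast
  ultimately show ?thesis
    using eqP P(1,2) W(1) germ_eq_iff[OF F V(1) V'(1) V(2) V'(2)] by metis
qed

lemma total_sheafify [simp]: "total (\<L> F) = etale F"
  and proj_sheafify [simp]: "proj (\<L> F) = fst"
  by (simp_all add: sheafify_def)

lemma act_sheafify_germ:
  assumes F: "psh F" and g: "g \<in> carrier G"
    and U: "U \<in> \<B>" "x \<in> U" "s \<in> psec F U" and V: "V \<in> \<B>" "\<phi> g x \<in> V" "V \<subseteq> \<phi> g ` U"
  shows "act (\<L> F) g (gm F x U s) = gm F (\<phi> g x) V (pmap F V U (inv g) s)"
proof -
  let ?P = "\<lambda>e'. \<exists>U'\<in>\<B>. \<exists>s'\<in>psec F U'. \<exists>x'\<in>U'. \<exists>V'\<in>\<B>.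
    gm F x U s = gm F x' U' s' \<and> \<phi> g x' \<in> V' \<and> V' \<subseteq> \<phi> g ` U' \<and>
          e' = gm F (\<phi> g x') V' (pmap F V' U' (inv g) s')"
  have "(THE e'. ?P e') = gm F (\<phi> g x) V (pmap F V U (inv g) s)"
  proof (rule the_equality)
    show "?P (gm F (\<phi> g x) V (pmap F V U (inv g) s))"
      using U V by blast
    fix e' assume "?P e'"
    then show "e' = gm F (\<phi> g x) V (pmap F V U (inv g) s)"
      using germ_translate_unique[OF F g U V] by metis
  qed
  then show ?thesis
    using U by (simp add: sheafify_def germ_mem_etale)
qed

lemma act_sheafify_germE:
  assumes F: "psh F" and g: "g \<in> carrier G" and U: "U \<in> \<B>" "x \<in> U" "s \<in> psec F U"
  obtains V where "V \<in> \<B>" "\<phi> g x \<in> V" "V \<subseteq> \<phi> g ` U" "pmap F V U (inv g) s \<in> psec F V"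
    "act (\<L> F) g (gm F x U s) = gm F (\<phi> g x) V (pmap F V U (inv g) s)"
proof -
  obtain V where V: "V \<in> \<B>" "\<phi> g x \<in> V" "V \<subseteq> \<phi> g ` U"
    using basis_refine_translate[OF U(1,2) g] .
  moreover have "pmap F V U (inv g) s \<in> psec F V"
    using F U V g G_space_image_inv_subset[OF G_space g] basis_subset by (intro pmap_closed) auto
  ultimately show thesis
    using that act_sheafify_germ[OF F g U V] by blast
qed

lemma group_action_sheafify:
  assumes F: "psh F"
  shows "group_action G (etale_set G X \<B> F) (act (\<L> F))"
proof (rule group_actionI)
  show "group G" by (rule group_axioms)
  show "act (\<L> F) g \<in> extensional (etale_set G X \<B> F)" for g
    by (simp add: sheafify_def)
  show "act (\<L> F) g e \<in> etale_set G X \<B> F" if g: "g \<in> carrier G" and e: "e \<in> etale_set G X \<B> F" for g e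
  proof -
    from e obtain U s x where U: "U \<in> \<B>" "x \<in> U" "s \<in> psec F U" "e = gm F x U s" by (rule etale_setE)
    then show ?thesis
      using act_sheafify_germE[OF F g U(1-3)] germ_mem_etale by metis
  qed
  show "act (\<L> F) \<one> e = e" if e: "e \<in> etale_set G X \<B> F" for e
  proof -
    from e obtain U s x where U: "U \<in> \<B>" "x \<in> U" "s \<in> psec F U" "e = gm F x U s" by (rule etale_setE)
    then have "\<phi> \<one> x = x" using \<phi>_one basis_mem by blast
    then show ?thesis
      using act_sheafify_germ[OF F one_closed U(1-3,1)] U
      by (simp add: translate_one pmap_one[OF F])
  qed
  show "act (\<L> F) (g \<otimes> h) e = act (\<L> F) g (act (\<L> F) h e)"
    if g: "g \<in> carrier G" and h: "h \<in> carrier G" and e: "e \<in> etale_set G X \<B> F" for g h e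
  proof -
    from e obtain U s x where U: "U \<in> \<B>" "x \<in> U" "s \<in> psec F U" "e = gm F x U s" by (rule etale_setE)
    obtain V where V: "V \<in> \<B>" "\<phi> h x \<in> V" "V \<subseteq> \<phi> h ` U" "pmap F V U (inv h) s \<in> psec F V"
      "act (\<L> F) h (gm F x U s) = gm F (\<phi> h x) V (pmap F V U (inv h) s)"
      by (rule act_sheafify_germE[OF F h U(1-3)])
    obtain W where W: "W \<in> \<B>" "\<phi> g (\<phi> h x) \<in> W" "W \<subseteq> \<phi> g ` V"
      "act (\<L> F) g (gm F (\<phi> h x) V (pmap F V U (inv h) s)) =
        gm F (\<phi> g (\<phi> h x)) W (pmap F W V (inv g) (pmap F V U (inv h) s))"
      by (rule act_sheafify_germE[OF F g V(1,2,4)])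
    have gh: "\<phi> (g \<otimes> h) y = \<phi> g (\<phi> h y)" if "y \<in> U" for y
      using \<phi>_mult[OF g h] basis_mem U that by blast
    then have "\<phi> (g \<otimes> h) ` U = \<phi> g ` \<phi> h ` U" by (auto simp: image_image)
    \<comment> \<open>The set chosen for acting by h and then by g is also admissible for the
      product, so all three actions are evaluated without another refinement.\<close>
    then have "W \<subseteq> \<phi> (g \<otimes> h) ` U"
      using subset_trans[OF W(3) image_mono[OF V(3)]] by simp
    then have "act (\<L> F) (g \<otimes> h) (gm F x U s) =
        gm F (\<phi> g (\<phi> h x)) W (pmap F W U (inv (g \<otimes> h)) s)"
      using act_sheafify_germ[OF F _ U(1-3) W(1)] g h W(2) gh U(2) by simp
    also have "pmap F W U (inv (g \<otimes> h)) s = pmap F W V (inv g) (pmap F V U (inv h) s)"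
    proof -
      have "\<phi> (inv g) ` W \<subseteq> V" "\<phi> (inv h) ` V \<subseteq> U"
        using G_space_image_inv_subset[OF G_space g basis_subset[OF V(1)] W(3)]
          G_space_image_inv_subset[OF G_space h basis_subset[OF U(1)] V(3)] .
      then show ?thesis
        using F U V(1) W(1) g h by (subst pmap_pmap) (auto simp: inv_mult_group)
    qed
    finally show ?thesis
      using U V W by simp
  qed
qed

text \<open>Near \<open>(g, s\<^sub>x)\<close> with \<open>s \<in> F(U)\<close> the action is controlled by elements \<open>g h\<close> with \<open>h\<close> in the
  stabilizer of the section \<open>s\<close>: then \<open>(g h)U = gU\<close> and \<open>F((g h)\<inverse>) s = F(g\<inverse>) s\<close>. That this
  stabilizer is open is where compactness of \<open>U\<close> and continuity of the presheaf are used.\<close>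

lemma continuous_map_act_sheafify:
  assumes F: "psh F"
  shows "continuous_map (prod_topology T (etale F)) (etale F) (\<lambda>(g, e). act (\<L> F) g e)"
proof -
  interpret A: group_action G "etale_set G X \<B> F" "act (\<L> F)"
    by (rule group_action_sheafify[OF F])
  let ?a = "\<lambda>(g, e). act (\<L> F) g e"
  let ?Z = "prod_topology T (etale F)"
  have Z: "topspace ?Z = carrier G \<times> etale_set G X \<B> F"
    by (simp add: topspace_T topspace_etale)
  have "continuous_map ?Z (topology_generated_by {(\<lambda>x. gm F x U s) ` U |U s. U \<in> \<B> \<and> s \<in> psec F U}) ?a"
  proof (rule continuous_on_generated_topo)
    have "?a ` topspace ?Z \<subseteq> topspace (etale F)"
      unfolding Z topspace_etale by (auto intro!: A.element_image[OF _ _ refl])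
    then show "?a ` topspace ?Z \<subseteq> \<Union> {(\<lambda>x. gm F x U s) ` U |U s. U \<in> \<B> \<and> s \<in> psec F U}"
      unfolding etale_topology_def topology_generated_by_topspace .
    fix A assume "A \<in> {(\<lambda>x. gm F x U s) ` U |U s. U \<in> \<B> \<and> s \<in> psec F U}"
    then obtain V t where V: "V \<in> \<B>" "t \<in> psec F V" "A = (\<lambda>x. gm F x V t) ` V" by blast
    show "openin ?Z (?a -` A \<inter> topspace ?Z)"
    proof (subst openin_subopen, intro ballI)
      fix z assume z: "z \<in> ?a -` A \<inter> topspace ?Z"
      then obtain g e where ge: "z = (g, e)" "g \<in> carrier G" "e \<in> etale_set G X \<B> F" "act (\<L> F) g e \<in> A"
        unfolding Z by auto
      from ge(3) obtain U s x where U: "U \<in> \<B>" "x \<in> U" "s \<in> psec F U" "e = gm F x U s"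
        by (rule etale_setE)
      have ig: "inv g \<in> carrier G" using ge by simp
      obtain P where P: "P \<in> \<B>" "\<phi> g x \<in> P" "P \<subseteq> \<phi> g ` U" "pmap F P U (inv g) s \<in> psec F P"
        "act (\<L> F) g (gm F x U s) = gm F (\<phi> g x) P (pmap F P U (inv g) s)"
        by (rule act_sheafify_germE[OF F ge(2) U(1-3)])
      obtain y where y: "y \<in> V" "gm F (\<phi> g x) P (pmap F P U (inv g) s) = gm F y V t"
        using ge(4) U(4) P(5) V(3) by auto
      have iP: "\<phi> (inv g) ` P \<subseteq> U"
        using G_space_image_inv_subset[OF G_space ge(2)] basis_subset U P by auto
      \<comment> \<open>On \<open>W\<close> the translate of s by g already agrees with t. It
        remains to keep nearby translates equal to this one and their base points inside
        \<open>W\<close>.\<close>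
      obtain W where W: "W \<in> \<B>" "\<phi> g x \<in> W" "W \<subseteq> P" "W \<subseteq> V"
        "pmap F W P \<one> (pmap F P U (inv g) s) = pmap F W V \<one> t"
        using y P V by (auto simp: germ_eq_iff[OF F])
      have Wt: "pmap F W U (inv g) s = pmap F W V \<one> t"
        using restriction_pmap[OF F W(1) P(1) U(1) W(3) ig iP U(3)] W(5) by simp
      let ?H = "{h \<in> set_stabilizer G \<phi> U. pmap F U U (inv h) s = s}"
      let ?gH = "{g' \<in> topspace T. inv g \<otimes> g' \<in> ?H}"
      \<comment> \<open>The first factor freezes the translate of U and of s, the second keeps s as
        representative, and the last condition places the moved base point in
        \<open>W\<close>.\<close>
      let ?N = "(?gH \<times> (\<lambda>x. gm F x U s) ` U) \<inter> {z \<in> topspace ?Z. \<phi> (fst z) (fst (snd z)) \<in> W}"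
      have "openin T ?gH"
        using continuous_map_translate[OF ig] openin_section_stabilizer[OF F U(1,3)]
        by (rule openin_continuous_map_preimage)
      moreover have "continuous_map ?Z X (\<lambda>z. \<phi> (fst z) (fst (snd z)))"
      proof (intro G_space_continuous_map[OF G_space] continuous_map_fst)
        show "continuous_map ?Z X (\<lambda>z. fst (snd z))"
          using continuous_map_compose[OF continuous_map_snd continuous_map_fst_etale[OF F]]
          by (simp add: o_def)
      qed
      ultimately have N: "openin ?Z ?N"
        using openin_germs[OF U(1,3)] basis_open[OF W(1)]
        by (intro openin_Int openin_prod_Times_iff[THEN iffD2] openin_continuous_map_preimage) auto
      have "\<one> \<in> ?H"
        using U by (auto simp: set_stabilizer_def translate_one pmap_one[OF F])
      then have zN: "z \<in> ?N"
        using ge U W by (auto simp: Z topspace_T topspace_etale)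
      have "?N \<subseteq> ?a -` A \<inter> topspace ?Z"
      proof
        fix z' assume z': "z' \<in> ?N"
        then obtain g' u where u: "z' = (g', gm F u U s)" "u \<in> U" "g' \<in> carrier G" "\<phi> g' u \<in> W"
          "inv g \<otimes> g' \<in> ?H" by (auto simp: Z topspace_T)
        define h where "h = inv g \<otimes> g'"
        have h: "h \<in> carrier G" "\<phi> h ` U = U" "pmap F U U (inv h) s = s"
          using u(5) unfolding h_def by (auto simp: set_stabilizer_def)
        have g': "g' = g \<otimes> h"
          using u(3) ge(2) by (simp add: h_def m_assoc[symmetric])
        have "\<phi> g' ` U = \<phi> g ` \<phi> h ` U"
          using \<phi>_mult[OF ge(2) h(1)] basis_mem[OF U(1)] by (auto simp: g' image_image)
        then have "W \<subseteq> \<phi> g' ` U" using W P h(2) by auto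
        then have "act (\<L> F) g' (gm F u U s) = gm F (\<phi> g' u) W (pmap F W U (inv g') s)"
          by (rule act_sheafify_germ[OF F u(3) U(1) u(2) U(3) W(1) u(4)])
        also have "pmap F W U (inv g') s = pmap F W U (inv g) (pmap F U U (inv h) s)"
        proof -
          have "\<phi> (inv g) ` W \<subseteq> U" using iP W by blast
          moreover have "\<phi> (inv h) ` U \<subseteq> U"
            using G_space_image_inv_subset[OF G_space h(1) basis_subset[OF U(1)], of U] h(2) by simp
          ultimately show ?thesis
            using F W U ge(2) h by (subst pmap_pmap) (auto simp: g' inv_mult_group)
        qed
        also have "\<dots> = pmap F W V \<one> t"
          using h(3) Wt by simp
        also have "gm F (\<phi> g' u) W \<dots> = gm F (\<phi> g' u) V t"
          by (rule germ_restriction[OF F V(1) W(1,4) u(4) V(2)])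
        finally have "?a z' \<in> A"
          using u W V by auto
        then show "z' \<in> ?a -` A \<inter> topspace ?Z"
          using z' by auto
      qed
      then show "\<exists>N. openin ?Z N \<and> z \<in> N \<and> N \<subseteq> ?a -` A \<inter> topspace ?Z"
        using N zN by blast
    qed
  qed
  then show ?thesis
    by (simp add: etale_topology_def)
qed

lemma G_sheaf_sheafify:
  assumes F: "psh F"
  shows "shf (\<L> F)"
  unfolding G_sheaf_def G_space_def total_sheafify proj_sheafify topspace_etale
proof (intro conjI ballI)
  fix g e assume g: "g \<in> carrier G" and e: "e \<in> etale_set G X \<B> F"
  from e obtain U s x where U: "U \<in> \<B>" "x \<in> U" "s \<in> psec F U" "e = gm F x U s" by (rule etale_setE)
  then show "fst (act (\<L> F) g e) = \<phi> g (fst e)"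
    using act_sheafify_germE[OF F g U(1-3)] by (metis fst_germ)
qed (rule group_action_sheafify[OF F] continuous_map_act_sheafify[OF F] local_homeomorphism_etale[OF F])+

section \<open>The forgetful functor\<close>

lemma shf_G_space: "shf E \<Longrightarrow> G_space G T (total E) (act E)"
  and shf_local_homeomorphism: "shf E \<Longrightarrow> local_homeomorphism (total E) X (proj E)"
  and shf_proj_act: "shf E \<Longrightarrow> g \<in> carrier G \<Longrightarrow> e \<in> topspace (total E) \<Longrightarrow>
    proj E (act E g e) = \<phi> g (proj E e)"
  by (simp_all add: G_sheaf_def)

lemma psec_forget [simp]: "psec (\<Gamma> E) = sections X E"
  and pmap_forget: "pmap (\<Gamma> E) U V g s = (\<lambda>x\<in>U. act E (inv g) (s (\<phi> g x)))"
  by (simp_all add: forget_def)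

lemma topspace_basis: "U \<in> \<B> \<Longrightarrow> topspace (subtopology X U) = U"
  using basis_subset by auto

lemma section_mem: "s \<in> sections X E U \<Longrightarrow> U \<in> \<B> \<Longrightarrow> x \<in> U \<Longrightarrow> s x \<in> topspace (total E)"
  and section_proj: "s \<in> sections X E U \<Longrightarrow> x \<in> U \<Longrightarrow> proj E (s x) = x"
  and section_continuous: "s \<in> sections X E U \<Longrightarrow> continuous_map (subtopology X U) (total E) s"
  and section_extensional: "s \<in> sections X E U \<Longrightarrow> s \<in> extensional U"
  using topspace_basis by (auto simp: sections_def continuous_map_def)

lemma sectionsI:
  assumes "U \<in> \<B>" "s \<in> extensional U" "continuous_map (subtopology X U) (total E) f"
    and "\<And>x. x \<in> U \<Longrightarrow> s x = f x" "\<And>x. x \<in> U \<Longrightarrow> proj E (s x) = x"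
  shows "s \<in> sections X E U"
  using assms continuous_map_eq[OF assms(3), of s] by (simp add: sections_def topspace_basis)

lemma pmap_forget_closed:
  assumes E: "shf E" and U: "U \<in> \<B>" and V: "V \<in> \<B>" and g: "g \<in> carrier G" "\<phi> g ` U \<subseteq> V"
    and s: "s \<in> sections X E V"
  shows "pmap (\<Gamma> E) U V g s \<in> sections X E U"
proof (rule sectionsI[OF U])
  have "continuous_map (subtopology X U) (subtopology X V) (\<phi> g)"
    using g by (auto simp: continuous_map_in_subtopology continuous_map_from_subtopology continuous_map_\<phi>)
  then have "continuous_map (subtopology X U) (total E) (\<lambda>x. s (\<phi> g x))"
    using continuous_map_compose[OF _ section_continuous[OF s]] by (simp add: o_def)
  then show "continuous_map (subtopology X U) (total E) (\<lambda>x. act E (inv g) (s (\<phi> g x)))"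
    using g by (intro G_space_continuous_map[OF shf_G_space[OF E]]) (auto simp: topspace_T)
  show "proj E (pmap (\<Gamma> E) U V g s x) = x" if x: "x \<in> U" for x
  proof -
    have "\<phi> g x \<in> V" using g x by blast
    then have "proj E (act E (inv g) (s (\<phi> g x))) = \<phi> (inv g) (\<phi> g x)"
      using shf_proj_act[OF E] section_mem[OF s V] section_proj[OF s] g by simp
    then show ?thesis
      using \<phi>_inv(1)[OF g(1) basis_mem[OF U x]] x by (simp add: pmap_forget)
  qed
qed (simp_all add: pmap_forget)

text \<open>The equation gs = t is an equation at each x in U between two points of E that both lie
  over x and vary continuously with (g, x). The equalizer is open, and compactness of U allows the
  quantifier over x. Arbitrary t is covered because all fibres are needed.\<close>

lemma openin_forget_stabilizer:
  assumes E: "shf E" and U: "U \<in> \<B>" and s: "s \<in> sections X E U" and t: "t \<in> sections X E U"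
  shows "openin (subtopology T (set_stabilizer G \<phi> U))
    {g \<in> set_stabilizer G \<phi> U. pmap (\<Gamma> E) U U (inv g) s = t}"
proof -
  let ?S = "subtopology T (set_stabilizer G \<phi> U)"
  let ?Y = "subtopology X U"
  let ?Z = "prod_topology ?S ?Y"
  have S: "topspace ?S = set_stabilizer G \<phi> U"
    by (auto simp: topspace_T set_stabilizer_def)
  have Z: "topspace ?Z = set_stabilizer G \<phi> U \<times> U"
    by (simp add: S topspace_basis[OF U] del: topspace_subtopology)
  have fst: "continuous_map ?Z T fst"
    using continuous_map_compose[OF continuous_map_fst continuous_map_from_subtopology[OF continuous_map_id]]
    by (simp add: o_def)
  have snd: "continuous_map ?Z X snd"
    using continuous_map_compose[OF continuous_map_snd continuous_map_from_subtopology[OF continuous_map_id]]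
    by (simp add: o_def)
  have carr: "g \<in> carrier G" if "g \<in> set_stabilizer G \<phi> U" for g
    using that by (simp add: set_stabilizer_def)
  have inv_mem: "\<phi> (inv g) x \<in> U" if "g \<in> set_stabilizer G \<phi> U" "x \<in> U" for g x
    using stabilizer_inv_subset[OF that(1) basis_subset[OF U]] that(2) by blast
  have "continuous_map ?Z T (\<lambda>z. inv (fst z))"
    using continuous_map_compose[OF fst continuous_map_inv] by (simp add: o_def)
  then have "continuous_map ?Z X (\<lambda>z. \<phi> (inv (fst z)) (snd z))"
    using snd by (rule G_space_continuous_map[OF G_space])
  then have "continuous_map ?Z ?Y (\<lambda>z. \<phi> (inv (fst z)) (snd z))"
    using inv_mem by (auto simp: continuous_map_in_subtopology Z simp del: topspace_prod_topology)
  then have "continuous_map ?Z (total E) (\<lambda>z. s (\<phi> (inv (fst z)) (snd z)))"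
    using continuous_map_compose[OF _ section_continuous[OF s]] by (simp add: o_def)
  then have 1: "continuous_map ?Z (total E) (\<lambda>z. act E (fst z) (s (\<phi> (inv (fst z)) (snd z))))"
    by (rule G_space_continuous_map[OF shf_G_space[OF E] fst])
  have 2: "continuous_map ?Z (total E) (\<lambda>z. t (snd z))"
    using continuous_map_compose[OF continuous_map_snd section_continuous[OF t]] by (simp add: o_def)
  let ?N = "{z \<in> topspace ?Z. act E (fst z) (s (\<phi> (inv (fst z)) (snd z))) = t (snd z)}"
  have "openin ?Z ?N"
  proof (rule openin_equalizer_local_homeomorphism[OF shf_local_homeomorphism[OF E] 1 2])
    fix z assume "z \<in> topspace ?Z"
    then have z: "fst z \<in> set_stabilizer G \<phi> U" "snd z \<in> U" by (auto simp: Z)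
    then have "proj E (act E (fst z) (s (\<phi> (inv (fst z)) (snd z)))) = \<phi> (fst z) (\<phi> (inv (fst z)) (snd z))"
      using shf_proj_act[OF E] section_mem[OF s U] section_proj[OF s] inv_mem carr by simp
    also have "\<dots> = proj E (t (snd z))"
      using \<phi>_inv(2)[OF carr[OF z(1)] basis_mem[OF U z(2)]] section_proj[OF t z(2)] by simp
    finally show "proj E (act E (fst z) (s (\<phi> (inv (fst z)) (snd z)))) = proj E (t (snd z))" .
  qed
  moreover have "compactin ?Y U"
    using basis_compact[OF U] by (simp add: compactin_subtopology)
  ultimately have "openin ?S {g \<in> topspace ?S. \<forall>x\<in>U. (g, x) \<in> ?N}"
    by (rule openin_forall_compactin)
  moreover have "{g \<in> topspace ?S. \<forall>x\<in>U. (g, x) \<in> ?N} =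
      {g \<in> set_stabilizer G \<phi> U. pmap (\<Gamma> E) U U (inv g) s = t}"
  proof -
    have "(\<forall>x\<in>U. (g, x) \<in> ?N) \<longleftrightarrow> pmap (\<Gamma> E) U U (inv g) s = t" if g: "g \<in> set_stabilizer G \<phi> U" for g
    proof -
      \<comment> \<open>Two inversions cancel: the left action uses the presheaf map of
        \<open>inv g\<close>, and that map again applies an inverse on E.\<close>
      have "pmap (\<Gamma> E) U U (inv g) s = t \<longleftrightarrow> (\<forall>x\<in>U. act E g (s (\<phi> (inv g) x)) = t x)"
        using section_extensional[OF t] carr[OF g]
        by (auto simp: pmap_forget intro!: extensionalityI[of _ U t])
      then show ?thesis using g by (simp add: Z del: topspace_prod_topology)
    qed
    then show ?thesis unfolding S by blast
  qed
  ultimately show ?thesis by simp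
qed

text \<open>Identifies the abstract restriction along \<one> with ordinary restriction of functions,
  so that naturality along inclusions becomes agreement of values.\<close>

lemma forget_restriction:
  assumes E: "shf E" and U: "U \<in> \<B>" and W: "W \<subseteq> U" and s: "s \<in> sections X E U"
  shows "pmap (\<Gamma> E) W U \<one> s = restrict s W"
  unfolding pmap_forget
proof (rule restrict_ext)
  fix x assume "x \<in> W"
  then have x: "x \<in> U" using W by blast
  show "act E (inv \<one>) (s (\<phi> \<one> x)) = s x"
    using G_space_one[OF shf_G_space[OF E] section_mem[OF s U x]] \<phi>_one[OF basis_mem[OF U x]] by simp
qed

lemma G_presheaf_forget:
  assumes E: "shf E"
  shows "psh (\<Gamma> E)"
  unfolding G_presheaf_def orbit_hom_def psec_forget
proof (intro conjI ballI)
  fix U V g assume "U \<in> \<B>" "V \<in> \<B>" "g \<in> {g \<in> carrier G. \<phi> g ` U \<subseteq> V}"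
  then show "pmap (\<Gamma> E) U V g \<in> sections X E V \<rightarrow> sections X E U"
    using pmap_forget_closed[OF E] by blast
next
  fix U s assume U: "U \<in> \<B>" and s: "s \<in> sections X E U"
  show "pmap (\<Gamma> E) U U \<one> s = s"
    using forget_restriction[OF E U subset_refl s] section_extensional[OF s] by (simp add: extensional_restrict)
next
  fix U V W g h s
  assume U: "U \<in> \<B>" and V: "V \<in> \<B>" and W: "W \<in> \<B>" and g': "g \<in> {g \<in> carrier G. \<phi> g ` U \<subseteq> V}"
    and h': "h \<in> {g \<in> carrier G. \<phi> g ` V \<subseteq> W}" and s: "s \<in> sections X E W"
  have g: "g \<in> carrier G" "\<phi> g ` U \<subseteq> V" and h: "h \<in> carrier G" "\<phi> h ` V \<subseteq> W" using g' h' by auto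
  have "act E (inv (h \<otimes> g)) (s (\<phi> (h \<otimes> g) x)) = act E (inv g) (restrict (\<lambda>x. act E (inv h) (s (\<phi> h x))) V (\<phi> g x))"
    if x: "x \<in> U" for x
  proof -
    have gx: "\<phi> g x \<in> V" using g x by blast
    then have "\<phi> h (\<phi> g x) \<in> W" using h by blast
    then have "s (\<phi> h (\<phi> g x)) \<in> topspace (total E)" by (rule section_mem[OF s W])
    then show ?thesis
      using G_space_mult[OF shf_G_space[OF E], of "inv g" "inv h"] g h gx \<phi>_mult[OF h(1) g(1) basis_mem[OF U x]]
      by (simp add: inv_mult_group)
  qed
  then show "pmap (\<Gamma> E) U W (h \<otimes> g) s = pmap (\<Gamma> E) U V g (pmap (\<Gamma> E) V W h s)"
    unfolding pmap_forget by (rule restrict_ext)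
next
  fix U assume U: "U \<in> \<B>"
  have top: "topspace (subtopology T (set_stabilizer G \<phi> U)) = set_stabilizer G \<phi> U"
    by (auto simp: topspace_T set_stabilizer_def)
  show "continuous_map (prod_topology (subtopology T (set_stabilizer G \<phi> U)) (discrete_topology (sections X E U)))
      (discrete_topology (sections X E U)) (\<lambda>(g, s). pmap (\<Gamma> E) U U (inv g) s)"
  proof (rule continuous_map_prod_discreteI, unfold top)
    fix g s assume g: "g \<in> set_stabilizer G \<phi> U" and s: "s \<in> sections X E U"
    show "pmap (\<Gamma> E) U U (inv g) s \<in> sections X E U"
      using stabilizer_inv_subset[OF g basis_subset[OF U]] g
      by (intro pmap_forget_closed[OF E U U _ _ s]) (auto simp: set_stabilizer_def)
  next
    fix s t assume "s \<in> sections X E U" "t \<in> sections X E U"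
    then show "openin (subtopology T (set_stabilizer G \<phi> U))
        {g \<in> set_stabilizer G \<phi> U. pmap (\<Gamma> E) U U (inv g) s = t}"
      by (rule openin_forget_stabilizer[OF E U])
  qed
qed

section \<open>Morphisms and the forgetful functor on them\<close>

lemma psh_hom_closed: "\<alpha> \<in> psh_hom G \<phi> \<B> F F' \<Longrightarrow> U \<in> \<B> \<Longrightarrow> s \<in> psec F U \<Longrightarrow> \<alpha> U s \<in> psec F' U"
  unfolding psh_hom_def by blast

lemma psh_hom_natural:
  "\<alpha> \<in> psh_hom G \<phi> \<B> F F' \<Longrightarrow> U \<in> \<B> \<Longrightarrow> V \<in> \<B> \<Longrightarrow> g \<in> carrier G \<Longrightarrow> \<phi> g ` U \<subseteq> V \<Longrightarrow> s \<in> psec F V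
    \<Longrightarrow> \<alpha> U (pmap F U V g s) = pmap F' U V g (\<alpha> V s)"
  unfolding psh_hom_def orbit_hom_def by blast

lemma psh_homI:
  assumes "\<alpha> \<in> extensional \<B>" "\<And>U. U \<in> \<B> \<Longrightarrow> \<alpha> U \<in> extensional (psec F U)"
    and "\<And>U s. U \<in> \<B> \<Longrightarrow> s \<in> psec F U \<Longrightarrow> \<alpha> U s \<in> psec F' U"
    and "\<And>U V g s. U \<in> \<B> \<Longrightarrow> V \<in> \<B> \<Longrightarrow> g \<in> carrier G \<Longrightarrow> \<phi> g ` U \<subseteq> V \<Longrightarrow> s \<in> psec F V
      \<Longrightarrow> \<alpha> U (pmap F U V g s) = pmap F' U V g (\<alpha> V s)"
  shows "\<alpha> \<in> psh_hom G \<phi> \<B> F F'"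
  using assms unfolding psh_hom_def orbit_hom_def PiE_def by auto

lemma psh_hom_eqI:
  assumes "\<alpha> \<in> psh_hom G \<phi> \<B> F F'" "\<beta> \<in> psh_hom G \<phi> \<B> F F'"
    and eq: "\<And>U s. U \<in> \<B> \<Longrightarrow> s \<in> psec F U \<Longrightarrow> \<alpha> U s = \<beta> U s"
  shows "\<alpha> = \<beta>"
proof -
  have \<alpha>: "\<alpha> \<in> (\<Pi>\<^sub>E U\<in>\<B>. psec F U \<rightarrow>\<^sub>E psec F' U)" and \<beta>: "\<beta> \<in> (\<Pi>\<^sub>E U\<in>\<B>. psec F U \<rightarrow>\<^sub>E psec F' U)"
    using assms by (auto simp: psh_hom_def)
  show ?thesis
  proof (rule PiE_ext[OF \<alpha> \<beta>])
    fix U assume U: "U \<in> \<B>"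
    show "\<alpha> U = \<beta> U"
      by (rule PiE_ext[OF PiE_mem[OF \<alpha> U] PiE_mem[OF \<beta> U] eq[OF U]])
  qed
qed

lemma psh_comp_apply: "U \<in> \<B> \<Longrightarrow> s \<in> psec F U \<Longrightarrow> psh_comp \<B> F \<beta> \<alpha> U s = \<beta> U (\<alpha> U s)"
  by (simp add: psh_comp_def compose_eq)

lemma psh_comp_hom:
  assumes F: "psh F" and \<alpha>: "\<alpha> \<in> psh_hom G \<phi> \<B> F F'" and \<beta>: "\<beta> \<in> psh_hom G \<phi> \<B> F' F''"
  shows "psh_comp \<B> F \<beta> \<alpha> \<in> psh_hom G \<phi> \<B> F F''"
proof (rule psh_homI)
  show "psh_comp \<B> F \<beta> \<alpha> \<in> extensional \<B>" by (simp add: psh_comp_def)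
  show "psh_comp \<B> F \<beta> \<alpha> U \<in> extensional (psec F U)" if "U \<in> \<B>" for U
    using that by (simp add: psh_comp_def compose_def)
  show "psh_comp \<B> F \<beta> \<alpha> U s \<in> psec F'' U" if "U \<in> \<B>" "s \<in> psec F U" for U s
    using that psh_hom_closed[OF \<beta>] psh_hom_closed[OF \<alpha>] by (simp add: psh_comp_apply)
  show "psh_comp \<B> F \<beta> \<alpha> U (pmap F U V g s) = pmap F'' U V g (psh_comp \<B> F \<beta> \<alpha> V s)"
    if "U \<in> \<B>" "V \<in> \<B>" "g \<in> carrier G" "\<phi> g ` U \<subseteq> V" "s \<in> psec F V" for U V g s
    using that psh_hom_natural[OF \<alpha>] psh_hom_natural[OF \<beta>] psh_hom_closed[OF \<alpha>] pmap_closed[OF F]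
    by (simp add: psh_comp_apply)
qed

lemma psh_id_hom: "psh F \<Longrightarrow> psh_id \<B> F \<in> psh_hom G \<phi> \<B> F F"
  by (rule psh_homI) (simp_all add: psh_id_def pmap_closed)

lemma sheaf_homI:
  assumes "f \<in> extensional (topspace (total D))" "continuous_map (total D) (total E) f"
    and "\<And>e. e \<in> topspace (total D) \<Longrightarrow> proj E (f e) = proj D e"
    and "\<And>g e. g \<in> carrier G \<Longrightarrow> e \<in> topspace (total D) \<Longrightarrow> f (act D g e) = act E g (f e)"
  shows "f \<in> sheaf_hom G D E"
  using assms by (simp add: sheaf_hom_def)

lemma sheaf_hom_extensional: "f \<in> sheaf_hom G D E \<Longrightarrow> f \<in> extensional (topspace (total D))"
  and sheaf_hom_continuous: "f \<in> sheaf_hom G D E \<Longrightarrow> continuous_map (total D) (total E) f"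
  and sheaf_hom_proj: "f \<in> sheaf_hom G D E \<Longrightarrow> e \<in> topspace (total D) \<Longrightarrow> proj E (f e) = proj D e"
  and sheaf_hom_act: "f \<in> sheaf_hom G D E \<Longrightarrow> g \<in> carrier G \<Longrightarrow> e \<in> topspace (total D)
    \<Longrightarrow> f (act D g e) = act E g (f e)"
  and sheaf_hom_closed: "f \<in> sheaf_hom G D E \<Longrightarrow> e \<in> topspace (total D) \<Longrightarrow> f e \<in> topspace (total E)"
  by (auto simp: sheaf_hom_def continuous_map_def)

text \<open>The composite is undefined off the total space, so equivariance can be evaluated at
  \<open>act C g e\<close> only if the action preserves the total space; hence the premise
  \<open>act\<close>.\<close>

lemma sheaf_comp_hom:
  assumes f: "f \<in> sheaf_hom G C D" and h: "h \<in> sheaf_hom G D E"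
    and act: "\<And>g e. g \<in> carrier G \<Longrightarrow> e \<in> topspace (total C) \<Longrightarrow> act C g e \<in> topspace (total C)"
  shows "sheaf_comp C h f \<in> sheaf_hom G C E"
proof (rule sheaf_homI)
  show "sheaf_comp C h f \<in> extensional (topspace (total C))"
    by (simp add: sheaf_comp_def compose_def)
  show "continuous_map (total C) (total E) (sheaf_comp C h f)"
    by (rule continuous_map_eq[OF continuous_map_compose[OF sheaf_hom_continuous[OF f] sheaf_hom_continuous[OF h]]])
      (simp add: sheaf_comp_def compose_def)
  show "proj E (sheaf_comp C h f e) = proj C e" if e: "e \<in> topspace (total C)" for e
    using sheaf_hom_proj[OF f e] sheaf_hom_proj[OF h sheaf_hom_closed[OF f e]] e
    by (simp add: sheaf_comp_def compose_eq)
  show "sheaf_comp C h f (act C g e) = act E g (sheaf_comp C h f e)"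
    if g: "g \<in> carrier G" and e: "e \<in> topspace (total C)" for g e
    using sheaf_hom_act[OF f g e] sheaf_hom_act[OF h g sheaf_hom_closed[OF f e]] e act[OF g e]
    by (simp add: sheaf_comp_def compose_eq)
qed

lemma forget_map_apply:
  "U \<in> \<B> \<Longrightarrow> s \<in> sections X D U \<Longrightarrow> forget_map X \<B> D f U s = (\<lambda>x\<in>U. f (s x))"
  by (simp add: forget_map_def compose_def)

lemma forget_map_section:
  assumes "f \<in> sheaf_hom G D E" "U \<in> \<B>" "s \<in> sections X D U"
  shows "(\<lambda>x\<in>U. f (s x)) \<in> sections X E U"
proof (rule sectionsI[OF assms(2)])
  show "continuous_map (subtopology X U) (total E) (f \<circ> s)"
    by (rule continuous_map_compose[OF section_continuous[OF assms(3)] sheaf_hom_continuous[OF assms(1)]])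
  show "proj E (restrict (\<lambda>x. f (s x)) U x) = x" if "x \<in> U" for x
    using sheaf_hom_proj[OF assms(1) section_mem[OF assms(3,2) that]] section_proj[OF assms(3) that] that
    by simp
qed simp_all

lemma forget_map_hom:
  assumes D: "shf D" and f: "f \<in> sheaf_hom G D E"
  shows "forget_map X \<B> D f \<in> psh_hom G \<phi> \<B> (\<Gamma> D) (\<Gamma> E)"
proof (rule psh_homI, unfold psec_forget)
  show "forget_map X \<B> D f \<in> extensional \<B>" by (simp add: forget_map_def)
  show "forget_map X \<B> D f U \<in> extensional (sections X D U)" if "U \<in> \<B>" for U
    using that by (simp add: forget_map_def)
  show "forget_map X \<B> D f U s \<in> sections X E U" if "U \<in> \<B>" "s \<in> sections X D U" for U s
    unfolding forget_map_apply[OF that] by (rule forget_map_section[OF f that])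
  fix U V g s
  assume U: "U \<in> \<B>" and V: "V \<in> \<B>" and g: "g \<in> carrier G" "\<phi> g ` U \<subseteq> V" and s: "s \<in> sections X D V"
  have "f (act D (inv g) (s (\<phi> g x))) = act E (inv g) (f (s (\<phi> g x)))" if "x \<in> U" for x
    using sheaf_hom_act[OF f] g section_mem[OF s V] that by (simp add: image_subset_iff)
  then show "forget_map X \<B> D f U (pmap (\<Gamma> D) U V g s) = pmap (\<Gamma> E) U V g (forget_map X \<B> D f V s)"
    unfolding forget_map_apply[OF U pmap_forget_closed[OF D U V g s]] forget_map_apply[OF V s]
    using g by (simp add: pmap_forget image_subset_iff cong: restrict_cong)
qed

lemma forget_map_id: "forget_map X \<B> E (sheaf_id E) = psh_id \<B> (\<Gamma> E)"
proof -
  have "compose U (sheaf_id E) s = s" if U: "U \<in> \<B>" and s: "s \<in> sections X E U" for U s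
    using section_mem[OF s U] extensional_restrict[OF section_extensional[OF s]]
    by (simp add: sheaf_id_def compose_def cong: restrict_cong)
  then show ?thesis
    by (simp add: forget_map_def psh_id_def cong: restrict_cong)
qed

lemma forget_map_comp:
  assumes f: "f \<in> sheaf_hom G E1 E2"
  shows "forget_map X \<B> E1 (sheaf_comp E1 h f) =
    psh_comp \<B> (\<Gamma> E1) (forget_map X \<B> E2 h) (forget_map X \<B> E1 f)"
proof -
  have "compose U (sheaf_comp E1 h f) s = forget_map X \<B> E2 h U (forget_map X \<B> E1 f U s)"
    if U: "U \<in> \<B>" and s: "s \<in> sections X E1 U" for U s
    using section_mem[OF s U] forget_map_section[OF f U s]
    by (simp add: forget_map_apply U s sheaf_comp_def compose_def cong: restrict_cong)
  then show ?thesis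
    by (simp add: forget_map_def[of X \<B> E1 "sheaf_comp E1 h f"] psh_comp_def compose_def[of "sections X E1 _"] cong: restrict_cong)
qed

section \<open>The adjunction\<close>

lemma topspace_sheafify: "topspace (total (\<L> F)) = etale_set G X \<B> F"
  by (simp add: topspace_etale)

lemma act_sheafify_closed:
  "psh F \<Longrightarrow> g \<in> carrier G \<Longrightarrow> e \<in> topspace (total (\<L> F)) \<Longrightarrow> act (\<L> F) g e \<in> topspace (total (\<L> F))"
  by (rule G_space_closed[OF shf_G_space[OF G_sheaf_sheafify]])

lemma unit_apply: "U \<in> \<B> \<Longrightarrow> s \<in> psec F U \<Longrightarrow> sheafify_unit G \<B> F U s = (\<lambda>x\<in>U. gm F x U s)"
  by (simp add: sheafify_unit_def)

lemma unit_section: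
  assumes F: "psh F" and U: "U \<in> \<B>" "s \<in> psec F U"
  shows "(\<lambda>x\<in>U. gm F x U s) \<in> sections X (\<L> F) U"
  using continuous_map_germ[OF assms] by (intro sectionsI[OF U(1)]) auto

lemma unit_hom:
  assumes F: "psh F"
  shows "sheafify_unit G \<B> F \<in> psh_hom G \<phi> \<B> F (\<Gamma> (\<L> F))"
proof (rule psh_homI, unfold psec_forget)
  show "sheafify_unit G \<B> F U s \<in> sections X (\<L> F) U" if "U \<in> \<B>" "s \<in> psec F U" for U s
    using unit_section[OF F that] unit_apply[OF that] by simp
  fix U V g s
  assume U: "U \<in> \<B>" and V: "V \<in> \<B>" and g: "g \<in> carrier G" "\<phi> g ` U \<subseteq> V" and s: "s \<in> psec F V"
  have ig: "inv g \<in> carrier G" using g by simp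
  have sub: "U \<subseteq> \<phi> (inv g) ` V"
    using G_space_subset_image[OF G_space ig basis_subset[OF U]] g by simp
  \<comment> \<open>The action of \<open>inv g\<close> on the germ at gx is evaluated with U itself
    as target set; the double inverse then gives the pullback along g.\<close>
  have "gm F x U (pmap F U V g s) = act (\<L> F) (inv g) (gm F (\<phi> g x) V s)" if x: "x \<in> U" for x
  proof -
    have "\<phi> (inv g) (\<phi> g x) = x" by (rule \<phi>_inv(1)[OF g(1) basis_mem[OF U x]])
    then show ?thesis
      using act_sheafify_germ[OF F ig V _ s U _ sub, of "\<phi> g x"] x g by (simp add: image_subset_iff)
  qed
  then show "sheafify_unit G \<B> F U (pmap F U V g s) = pmap (\<Gamma> (\<L> F)) U V g (sheafify_unit G \<B> F V s)"
    using g pmap_closed[OF F U V g s] by (simp add: unit_apply U V s pmap_forget image_subset_iff cong: restrict_cong)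
qed (simp_all add: sheafify_unit_def)

lemma adjunct_apply:
  assumes F: "psh F" and U: "U \<in> \<B>" "s \<in> psec F U"
  shows "adjunct G X \<phi> \<B> F f U s = (\<lambda>x\<in>U. f (gm F x U s))"
  using unit_section[OF assms] U
  by (simp add: adjunct_def psh_comp_apply unit_apply forget_map_apply cong: restrict_cong)

lemma adjunct_hom:
  assumes F: "psh F" and f: "f \<in> sheaf_hom G (\<L> F) E"
  shows "adjunct G X \<phi> \<B> F f \<in> psh_hom G \<phi> \<B> F (\<Gamma> E)"
  unfolding adjunct_def
  by (rule psh_comp_hom[OF F unit_hom[OF F] forget_map_hom[OF G_sheaf_sheafify[OF F] f]])

text \<open>Each requirement on f mirrors one on \<alpha>: continuity and compatibility with
  projections hold because the \<alpha> U s are sections, and equivariance under g is naturality for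
  \<open>inv g\<close> as a morphism from V to U. The map f is arbitrary so that the lemma also
  covers \<open>sheafify_map\<close>.\<close>

lemma transpose_hom:
  assumes F: "psh F" and E: "shf E" and \<alpha>: "\<alpha> \<in> psh_hom G \<phi> \<B> F (\<Gamma> E)"
    and ext: "f \<in> extensional (etale_set G X \<B> F)"
    and f: "\<And>U x s. U \<in> \<B> \<Longrightarrow> x \<in> U \<Longrightarrow> s \<in> psec F U \<Longrightarrow> f (gm F x U s) = \<alpha> U s x"
  shows "f \<in> sheaf_hom G (\<L> F) E"
proof (rule sheaf_homI, unfold topspace_sheafify)
  have \<alpha>_sec: "\<alpha> U s \<in> sections X E U" if "U \<in> \<B>" "s \<in> psec F U" for U s
    using psh_hom_closed[OF \<alpha> that] by simp
  show "continuous_map (total (\<L> F)) (total E) f"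
    unfolding total_sheafify
  proof (rule continuous_map_from_etale[OF F])
    fix U s assume U: "U \<in> \<B>" "s \<in> psec F U"
    show "continuous_map (subtopology X U) (total E) (\<lambda>x. f (gm F x U s))"
      by (rule continuous_map_eq[OF section_continuous[OF \<alpha>_sec[OF U]]])
        (simp add: topspace_basis f U del: topspace_subtopology)
  qed
  show "proj E (f e) = proj (\<L> F) e" if e: "e \<in> etale_set G X \<B> F" for e
  proof -
    from e obtain U s x where U: "U \<in> \<B>" "x \<in> U" "s \<in> psec F U" "e = gm F x U s" by (rule etale_setE)
    then show ?thesis
      using section_proj[OF \<alpha>_sec] f by simp
  qed
  show "f (act (\<L> F) g e) = act E g (f e)" if g: "g \<in> carrier G" and e: "e \<in> etale_set G X \<B> F" for g e
  proof -
    from e obtain U s x where U: "U \<in> \<B>" "x \<in> U" "s \<in> psec F U" "e = gm F x U s" by (rule etale_setE)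
    obtain V where V: "V \<in> \<B>" "\<phi> g x \<in> V" "V \<subseteq> \<phi> g ` U" "pmap F V U (inv g) s \<in> psec F V"
      "act (\<L> F) g (gm F x U s) = gm F (\<phi> g x) V (pmap F V U (inv g) s)"
      by (rule act_sheafify_germE[OF F g U(1-3)])
    have "f (act (\<L> F) g e) = \<alpha> V (pmap F V U (inv g) s) (\<phi> g x)"
      using f[OF V(1,2,4)] V(5) U(4) by simp
    also have "\<dots> = pmap (\<Gamma> E) V U (inv g) (\<alpha> U s) (\<phi> g x)"
      using psh_hom_natural[OF \<alpha> V(1) U(1) _ G_space_image_inv_subset[OF G_space g basis_subset[OF U(1)] V(3)] U(3)] g
      by simp
    also have "\<dots> = act E g (\<alpha> U s (\<phi> (inv g) (\<phi> g x)))"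
      using V(2) g by (simp add: pmap_forget)
    also have "\<dots> = act E g (f e)"
      using \<phi>_inv(1)[OF g basis_mem[OF U(1,2)]] f[OF U(1-3)] U(4) by simp
    finally show ?thesis .
  qed
qed (rule ext)

lemma restriction_natural:
  assumes "psh F" "\<alpha> \<in> psh_hom G \<phi> \<B> F F'" "W \<in> \<B>" "U \<in> \<B>" "W \<subseteq> U" "s \<in> psec F U"
  shows "\<alpha> W (pmap F W U \<one> s) = pmap F' W U \<one> (\<alpha> U s)"
  using assms by (intro psh_hom_natural) (auto simp: translate_one)

text \<open>The value \<alpha> U s x depends only on the germ, because \<alpha> commutes with
  restrictions and restriction of sections does not change values.\<close>

lemma transpose_exists:
  assumes F: "psh F" and E: "shf E" and \<alpha>: "\<alpha> \<in> psh_hom G \<phi> \<B> F (\<Gamma> E)"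
  obtains f where "f \<in> sheaf_hom G (\<L> F) E"
    "\<And>U x s. U \<in> \<B> \<Longrightarrow> x \<in> U \<Longrightarrow> s \<in> psec F U \<Longrightarrow> f (gm F x U s) = \<alpha> U s x"
proof -
  define f where "f = (\<lambda>e\<in>etale_set G X \<B> F.
    THE e'. \<exists>V\<in>\<B>. \<exists>t\<in>psec F V. \<exists>y\<in>V. e = gm F y V t \<and> e' = \<alpha> V t y)"
  have f: "f (gm F x U s) = \<alpha> U s x" if U: "U \<in> \<B>" "x \<in> U" "s \<in> psec F U" for U x s
  proof -
    have "\<alpha> W (pmap F W V \<one> t) y = \<alpha> V t y"
      if "W \<in> \<B>" "V \<in> \<B>" "W \<subseteq> V" "y \<in> W" "t \<in> psec F V" for W V y t
      using restriction_natural[OF F \<alpha> that(1-3,5)] psh_hom_closed[OF \<alpha> that(2,5)] that(4)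
      by (simp add: forget_restriction[OF E that(2,3)])
    from the_germ_value[OF F, of "\<lambda>y V t. \<alpha> V t y", OF this U] show ?thesis
      unfolding f_def using germ_mem_etale[OF U] by simp
  qed
  moreover have "f \<in> sheaf_hom G (\<L> F) E"
    by (rule transpose_hom[OF F E \<alpha> _ f]) (simp_all only: f_def restrict_extensional)
  ultimately show thesis using that by blast
qed

text \<open>The value of the adjunct at U, s and x is the value of f at a germ, and every point of
  \<ell>F is a germ; this gives injectivity. Surjectivity is the existence of transposes.\<close>

lemma adjunct_bij:
  assumes F: "psh F" and E: "shf E"
  shows "bij_betw (adjunct G X \<phi> \<B> F) (sheaf_hom G (\<L> F) E) (psh_hom G \<phi> \<B> F (\<Gamma> E))"
  unfolding bij_betw_def
proof
  show "inj_on (adjunct G X \<phi> \<B> F) (sheaf_hom G (\<L> F) E)"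
  proof (rule inj_onI)
    fix f h assume f: "f \<in> sheaf_hom G (\<L> F) E" and h: "h \<in> sheaf_hom G (\<L> F) E"
      and eq: "adjunct G X \<phi> \<B> F f = adjunct G X \<phi> \<B> F h"
    show "f = h"
    proof (rule etale_set_extensionalityI)
      show "f \<in> extensional (etale_set G X \<B> F)" "h \<in> extensional (etale_set G X \<B> F)"
        using sheaf_hom_extensional[OF f] sheaf_hom_extensional[OF h] by (simp_all only: topspace_sheafify)
      fix U x s assume U: "U \<in> \<B>" "x \<in> U" "s \<in> psec F U"
      then show "f (gm F x U s) = h (gm F x U s)"
        using arg_cong[OF eq, of "\<lambda>\<alpha>. \<alpha> U s x"] by (simp add: adjunct_apply[OF F])
    qed
  qed
  show "adjunct G X \<phi> \<B> F ` sheaf_hom G (\<L> F) E = psh_hom G \<phi> \<B> F (\<Gamma> E)"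
  proof
    show "adjunct G X \<phi> \<B> F ` sheaf_hom G (\<L> F) E \<subseteq> psh_hom G \<phi> \<B> F (\<Gamma> E)"
      using adjunct_hom[OF F] by blast
    show "psh_hom G \<phi> \<B> F (\<Gamma> E) \<subseteq> adjunct G X \<phi> \<B> F ` sheaf_hom G (\<L> F) E"
    proof
      fix \<alpha> assume \<alpha>: "\<alpha> \<in> psh_hom G \<phi> \<B> F (\<Gamma> E)"
      obtain f where f: "f \<in> sheaf_hom G (\<L> F) E"
        "\<And>U x s. U \<in> \<B> \<Longrightarrow> x \<in> U \<Longrightarrow> s \<in> psec F U \<Longrightarrow> f (gm F x U s) = \<alpha> U s x"
        using transpose_exists[OF F E \<alpha>] by blast
      have "adjunct G X \<phi> \<B> F f = \<alpha>"
      proof (rule psh_hom_eqI[OF adjunct_hom[OF F f(1)] \<alpha>])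
        fix U s assume U: "U \<in> \<B>" "s \<in> psec F U"
        have "\<alpha> U s \<in> extensional U"
          using section_extensional psh_hom_closed[OF \<alpha> U] by simp
        then show "adjunct G X \<phi> \<B> F f U s = \<alpha> U s"
          using f(2) U by (simp add: adjunct_apply[OF F] extensional_restrict cong: restrict_cong)
      qed
      then show "\<alpha> \<in> adjunct G X \<phi> \<B> F ` sheaf_hom G (\<L> F) E" using f(1) by blast
    qed
  qed
qed

section \<open>Sheafification on morphisms\<close>

lemma sheafify_map_germ:
  assumes F: "psh F" and F': "psh F'" and \<alpha>: "\<alpha> \<in> psh_hom G \<phi> \<B> F F'"
    and U: "U \<in> \<B>" "x \<in> U" "s \<in> psec F U"
  shows "sheafify_map G X \<B> F F' \<alpha> (gm F x U s) = gm F' x U (\<alpha> U s)"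
proof -
  have "gm F' y W (\<alpha> W (pmap F W V \<one> t)) = gm F' y V (\<alpha> V t)"
    if "W \<in> \<B>" "V \<in> \<B>" "W \<subseteq> V" "y \<in> W" "t \<in> psec F V" for W V y t
    using restriction_natural[OF F \<alpha> that(1-3,5)] psh_hom_closed[OF \<alpha> that(2,5)] that
    by (simp add: germ_restriction[OF F'])
  from the_germ_value[OF F, of "\<lambda>y V t. gm F' y V (\<alpha> V t)", OF this U] show ?thesis
    unfolding sheafify_map_def using germ_mem_etale[OF U] by simp
qed

lemma sheafify_map_extensional: "sheafify_map G X \<B> F F' \<alpha> \<in> extensional (etale_set G X \<B> F)"
  by (simp add: sheafify_map_def)

text \<open>The induced map is the transpose of \<alpha> followed by the unit of the target, so no
  separate check of continuity or equivariance is required.\<close>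

lemma sheafify_map_hom:
  assumes F: "psh F" and F': "psh F'" and \<alpha>: "\<alpha> \<in> psh_hom G \<phi> \<B> F F'"
  shows "sheafify_map G X \<B> F F' \<alpha> \<in> sheaf_hom G (\<L> F) (\<L> F')"
proof (rule transpose_hom[OF F G_sheaf_sheafify[OF F'] psh_comp_hom[OF F \<alpha> unit_hom[OF F']]])
  fix U x s assume U: "U \<in> \<B>" "x \<in> U" "s \<in> psec F U"
  then show "sheafify_map G X \<B> F F' \<alpha> (gm F x U s) = psh_comp \<B> F (sheafify_unit G \<B> F') \<alpha> U s x"
    using psh_hom_closed[OF \<alpha>] by (simp add: sheafify_map_germ[OF assms U] psh_comp_apply unit_apply)
qed (rule sheafify_map_extensional)

lemma sheafify_map_id:
  assumes F: "psh F"
  shows "sheafify_map G X \<B> F F (psh_id \<B> F) = sheaf_id (\<L> F)"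
proof (rule etale_set_extensionalityI[OF sheafify_map_extensional])
  show "sheaf_id (\<L> F) \<in> extensional (etale_set G X \<B> F)"
    unfolding sheaf_id_def topspace_sheafify by simp
  fix U x s assume U: "U \<in> \<B>" "x \<in> U" "s \<in> psec F U"
  then have "psh_id \<B> F U s = s" by (simp add: psh_id_def)
  with U show "sheafify_map G X \<B> F F (psh_id \<B> F) (gm F x U s) = sheaf_id (\<L> F) (gm F x U s)"
    unfolding sheaf_id_def topspace_sheafify
    by (simp add: sheafify_map_germ[OF F F psh_id_hom[OF F]] germ_mem_etale)
qed

lemma sheaf_comp_germ:
  "U \<in> \<B> \<Longrightarrow> x \<in> U \<Longrightarrow> s \<in> psec F U \<Longrightarrow> sheaf_comp (\<L> F) h f (gm F x U s) = h (f (gm F x U s))"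
  unfolding sheaf_comp_def topspace_sheafify by (simp add: compose_eq germ_mem_etale)

lemma sheaf_comp_extensional: "sheaf_comp (\<L> F) h f \<in> extensional (etale_set G X \<B> F)"
  unfolding sheaf_comp_def topspace_sheafify by (simp add: compose_def)

lemma sheafify_map_comp:
  assumes F: "psh F1" "psh F2" "psh F3"
    and \<alpha>: "\<alpha> \<in> psh_hom G \<phi> \<B> F1 F2" and \<beta>: "\<beta> \<in> psh_hom G \<phi> \<B> F2 F3"
  shows "sheafify_map G X \<B> F1 F3 (psh_comp \<B> F1 \<beta> \<alpha>) =
    sheaf_comp (\<L> F1) (sheafify_map G X \<B> F2 F3 \<beta>) (sheafify_map G X \<B> F1 F2 \<alpha>)"
proof (rule etale_set_extensionalityI[OF sheafify_map_extensional sheaf_comp_extensional])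
  fix U x s assume U: "U \<in> \<B>" "x \<in> U" "s \<in> psec F1 U"
  then show "sheafify_map G X \<B> F1 F3 (psh_comp \<B> F1 \<beta> \<alpha>) (gm F1 x U s) =
      sheaf_comp (\<L> F1) (sheafify_map G X \<B> F2 F3 \<beta>) (sheafify_map G X \<B> F1 F2 \<alpha>) (gm F1 x U s)"
    using psh_hom_closed[OF \<alpha>]
    by (simp add: sheaf_comp_germ sheafify_map_germ[OF F(1,3) psh_comp_hom[OF F(1) \<alpha> \<beta>]]
        sheafify_map_germ[OF F(1,2) \<alpha>] sheafify_map_germ[OF F(2,3) \<beta>] psh_comp_apply)
qed

section \<open>Naturality of the adjunction and its unit\<close>

lemma adjunct_natural_sheaf:
  assumes F: "psh F" and E1: "shf E1" and f: "f \<in> sheaf_hom G (\<L> F) E1" and h: "h \<in> sheaf_hom G E1 E2"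
  shows "adjunct G X \<phi> \<B> F (sheaf_comp (\<L> F) h f) =
    psh_comp \<B> F (forget_map X \<B> E1 h) (adjunct G X \<phi> \<B> F f)"
proof (rule psh_hom_eqI)
  show "adjunct G X \<phi> \<B> F (sheaf_comp (\<L> F) h f) \<in> psh_hom G \<phi> \<B> F (\<Gamma> E2)"
    by (rule adjunct_hom[OF F sheaf_comp_hom[OF f h act_sheafify_closed[OF F]]])
  show "psh_comp \<B> F (forget_map X \<B> E1 h) (adjunct G X \<phi> \<B> F f) \<in> psh_hom G \<phi> \<B> F (\<Gamma> E2)"
    by (rule psh_comp_hom[OF F adjunct_hom[OF F f] forget_map_hom[OF E1 h]])
  fix U s assume U: "U \<in> \<B>" "s \<in> psec F U"
  have "(\<lambda>x\<in>U. f (gm F x U s)) \<in> sections X E1 U"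
    using psh_hom_closed[OF adjunct_hom[OF F f] U] by (simp add: adjunct_apply[OF F U])
  then show "adjunct G X \<phi> \<B> F (sheaf_comp (\<L> F) h f) U s =
      psh_comp \<B> F (forget_map X \<B> E1 h) (adjunct G X \<phi> \<B> F f) U s"
    using U by (simp add: adjunct_apply[OF F] psh_comp_apply forget_map_apply sheaf_comp_germ cong: restrict_cong)
qed

lemma adjunct_natural_presheaf:
  assumes F: "psh F1" "psh F2" and \<alpha>: "\<alpha> \<in> psh_hom G \<phi> \<B> F1 F2" and f: "f \<in> sheaf_hom G (\<L> F2) E"
  shows "adjunct G X \<phi> \<B> F1 (sheaf_comp (\<L> F1) f (sheafify_map G X \<B> F1 F2 \<alpha>)) =
    psh_comp \<B> F1 (adjunct G X \<phi> \<B> F2 f) \<alpha>"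
proof (rule psh_hom_eqI)
  show "adjunct G X \<phi> \<B> F1 (sheaf_comp (\<L> F1) f (sheafify_map G X \<B> F1 F2 \<alpha>)) \<in> psh_hom G \<phi> \<B> F1 (\<Gamma> E)"
    by (rule adjunct_hom[OF F(1) sheaf_comp_hom[OF sheafify_map_hom[OF F \<alpha>] f act_sheafify_closed[OF F(1)]]])
  show "psh_comp \<B> F1 (adjunct G X \<phi> \<B> F2 f) \<alpha> \<in> psh_hom G \<phi> \<B> F1 (\<Gamma> E)"
    by (rule psh_comp_hom[OF F(1) \<alpha> adjunct_hom[OF F(2) f]])
  fix U s assume U: "U \<in> \<B>" "s \<in> psec F1 U"
  then show "adjunct G X \<phi> \<B> F1 (sheaf_comp (\<L> F1) f (sheafify_map G X \<B> F1 F2 \<alpha>)) U s =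
      psh_comp \<B> F1 (adjunct G X \<phi> \<B> F2 f) \<alpha> U s"
    using psh_hom_closed[OF \<alpha> U]
    by (simp add: adjunct_apply[OF F(1)] adjunct_apply[OF F(2)] psh_comp_apply sheaf_comp_germ
        sheafify_map_germ[OF F \<alpha>] cong: restrict_cong)
qed

lemma adjunct_id:
  assumes F: "psh F"
  shows "adjunct G X \<phi> \<B> F (sheaf_id (\<L> F)) = sheafify_unit G \<B> F"
proof -
  have "psh_comp \<B> F (psh_id \<B> (\<Gamma> (\<L> F))) (sheafify_unit G \<B> F) = sheafify_unit G \<B> F"
    using unit_section[OF F] unit_apply
    by (simp add: psh_comp_def psh_id_def compose_def sheafify_unit_def cong: restrict_cong)
  then show ?thesis
    by (simp only: adjunct_def forget_map_id)
qed

section \<open>Idempotence\<close>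

text \<open>The point s(x) is the germ of some t. Both s and the germ section of t are continuous
  sections of a local homeomorphism that meet at x, hence they agree near x.\<close>

lemma section_locally_germ:
  assumes F: "psh F" and U: "U \<in> \<B>" "x \<in> U" and s: "s \<in> sections X (\<L> F) U"
  obtains W t where "W \<in> \<B>" "x \<in> W" "W \<subseteq> U" "t \<in> psec F W" "\<And>z. z \<in> W \<Longrightarrow> s z = gm F z W t"
proof -
  have "s x \<in> etale_set G X \<B> F"
    using section_mem[OF s U] by (simp only: topspace_sheafify)
  then obtain V t y where V: "V \<in> \<B>" "y \<in> V" "t \<in> psec F V" and sx: "s x = gm F y V t"
    by (rule etale_setE)
  have xy: "y = x" using section_proj[OF s U(2)] sx by simp
  have UV: "openin X (U \<inter> V)" using U V basis_open by blast
  have top: "topspace (subtopology X (U \<inter> V)) = U \<inter> V"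
    using openin_subset[OF UV] by auto
  have "openin (subtopology X (U \<inter> V)) {z \<in> topspace (subtopology X (U \<inter> V)). s z = gm F z V t}"
  proof (rule openin_equalizer_local_homeomorphism[OF local_homeomorphism_etale[OF F]])
    show "continuous_map (subtopology X (U \<inter> V)) (etale F) s"
      using continuous_map_from_subtopology_mono[OF section_continuous[OF s], of "U \<inter> V"] by simp
    show "continuous_map (subtopology X (U \<inter> V)) (etale F) (\<lambda>z. gm F z V t)"
      using continuous_map_from_subtopology_mono[OF continuous_map_germ[OF F V(1,3)], of "U \<inter> V"] by simp
    show "fst (s z) = fst (gm F z V t)" if "z \<in> topspace (subtopology X (U \<inter> V))" for z
      using section_proj[OF s, of z] that by (simp add: top del: topspace_subtopology)
  qed
  then have "openin X {z \<in> U \<inter> V. s z = gm F z V t}"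
    unfolding top openin_open_subtopology[OF UV] by simp
  then obtain W where W: "W \<in> \<B>" "x \<in> W" "W \<subseteq> {z \<in> U \<inter> V. s z = gm F z V t}"
    by (rule basis_refine) (use U V sx xy in auto)
  have WV: "W \<subseteq> V" using W by blast
  show thesis
  proof (rule that[of W "pmap F W V \<one> t"])
    show "pmap F W V \<one> t \<in> psec F W"
      by (rule restriction_closed[OF F W(1) V(1) WV V(3)])
    show "s z = gm F z W (pmap F W V \<one> t)" if z: "z \<in> W" for z
      using W z germ_restriction[OF F V(1) W(1) WV z V(3)] by auto
  qed (use W in auto)
qed

text \<open>The functor \<ell> applied to the unit at F, as a map of sheaves;
  \<open>forget_map_can\<close> compares it with the unit at \<ell>F, which is a map of
  presheaves.\<close>

abbreviation can where
  "can F \<equiv> sheafify_map G X \<B> F (\<Gamma> (\<L> F)) (sheafify_unit G \<B> F)"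

lemma psh_forget_sheafify: "psh F \<Longrightarrow> psh (\<Gamma> (\<L> F))"
  by (intro G_presheaf_forget G_sheaf_sheafify)

text \<open>Near x the section is the germ section of some t. The canonical map sends the germ of t
  to the germ of the unit image of t, and that image is s restricted to \<open>W\<close>.\<close>

lemma can_section:
  assumes F: "psh F" and U: "U \<in> \<B>" "x \<in> U" and s: "s \<in> sections X (\<L> F) U"
  shows "can F (s x) = gm (\<Gamma> (\<L> F)) x U s"
proof -
  obtain W t where W: "W \<in> \<B>" "x \<in> W" "W \<subseteq> U" "t \<in> psec F W" "\<And>z. z \<in> W \<Longrightarrow> s z = gm F z W t"
    using section_locally_germ[OF assms] by blast
  have "can F (s x) = gm (\<Gamma> (\<L> F)) x W (\<lambda>z\<in>W. gm F z W t)"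
    using sheafify_map_germ[OF F psh_forget_sheafify[OF F] unit_hom[OF F] W(1,2,4)] W
    by (simp add: unit_apply)
  also have "(\<lambda>z\<in>W. gm F z W t) = pmap (\<Gamma> (\<L> F)) W U \<one> s"
    using W(5) by (simp add: forget_restriction[OF G_sheaf_sheafify[OF F] U(1) W(3) s] cong: restrict_cong)
  also have "gm (\<Gamma> (\<L> F)) x W \<dots> = gm (\<Gamma> (\<L> F)) x U s"
    using s by (intro germ_restriction[OF psh_forget_sheafify[OF F] U(1) W(1,3,2)]) simp
  finally show ?thesis .
qed

text \<open>The inverse is the counit, obtained as the transpose of the identity. The first
  composite is a triangle identity; the second is \<open>can_section\<close>.\<close>

lemma can_inverse:
  assumes F: "psh F"
  obtains \<epsilon> where "\<epsilon> \<in> sheaf_hom G (\<L> (\<Gamma> (\<L> F))) (\<L> F)"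
    "sheaf_comp (\<L> F) \<epsilon> (can F) = sheaf_id (\<L> F)"
    "sheaf_comp (\<L> (\<Gamma> (\<L> F))) (can F) \<epsilon> = sheaf_id (\<L> (\<Gamma> (\<L> F)))"
proof -
  let ?F' = "\<Gamma> (\<L> F)"
  have F': "psh ?F'" by (rule psh_forget_sheafify[OF F])
  obtain \<epsilon> where \<epsilon>: "\<epsilon> \<in> sheaf_hom G (\<L> ?F') (\<L> F)"
    and "\<And>U x s. U \<in> \<B> \<Longrightarrow> x \<in> U \<Longrightarrow> s \<in> psec ?F' U \<Longrightarrow> \<epsilon> (gm ?F' x U s) = psh_id \<B> ?F' U s x"
    using transpose_exists[OF F' G_sheaf_sheafify[OF F] psh_id_hom[OF F']] by blast
  then have \<epsilon>_germ: "\<epsilon> (gm ?F' x U s) = s x" if "U \<in> \<B>" "x \<in> U" "s \<in> sections X (\<L> F) U" for U x s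
    using that by (simp add: psh_id_def)
  have "sheaf_comp (\<L> F) \<epsilon> (can F) = sheaf_id (\<L> F)"
  proof (rule etale_set_extensionalityI[OF sheaf_comp_extensional])
    fix U x s assume U: "U \<in> \<B>" "x \<in> U" "s \<in> psec F U"
    then show "sheaf_comp (\<L> F) \<epsilon> (can F) (gm F x U s) = sheaf_id (\<L> F) (gm F x U s)"
      unfolding sheaf_id_def topspace_sheafify
      using \<epsilon>_germ[OF U(1,2) unit_section[OF F U(1,3)]]
      by (simp add: sheaf_comp_germ sheafify_map_germ[OF F F' unit_hom[OF F]] unit_apply germ_mem_etale)
  qed (unfold sheaf_id_def topspace_sheafify, simp)
  moreover have "sheaf_comp (\<L> ?F') (can F) \<epsilon> = sheaf_id (\<L> ?F')"
  proof (rule etale_set_extensionalityI[OF sheaf_comp_extensional])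
    fix U x s assume U: "U \<in> \<B>" "x \<in> U" "s \<in> psec ?F' U"
    then show "sheaf_comp (\<L> ?F') (can F) \<epsilon> (gm ?F' x U s) = sheaf_id (\<L> ?F') (gm ?F' x U s)"
      unfolding sheaf_id_def topspace_sheafify
      by (simp add: sheaf_comp_germ \<epsilon>_germ can_section[OF F] germ_mem_etale)
  qed (unfold sheaf_id_def topspace_sheafify, simp)
  ultimately show thesis using that \<epsilon> by blast
qed

text \<open>This is \<open>can_section\<close> read at all points of a section at once.\<close>

lemma forget_map_can:
  assumes F: "psh F"
  shows "forget_map X \<B> (\<L> F) (can F) = sheafify_unit G \<B> (\<Gamma> (\<L> F))"
  unfolding forget_map_def sheafify_unit_def[of G \<B> "\<Gamma> (\<L> F)"] psec_forget compose_def
  by (intro restrict_ext can_section[OF F])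

lemma can_hom:
  assumes F: "psh F"
  shows "can F \<in> sheaf_hom G (\<L> F) (\<L> (\<Gamma> (\<L> F)))"
  by (rule sheafify_map_hom[OF F psh_forget_sheafify[OF F] unit_hom[OF F]])

lemma can_iso:
  assumes F: "psh F"
  shows "can F \<in> sheaf_iso G (\<L> F) (\<L> (\<Gamma> (\<L> F)))"
  using can_inverse[OF F] can_hom[OF F] unfolding sheaf_iso_def by blast

text \<open>The forgetful functor carries the canonical isomorphism and its inverse to inverse
  presheaf maps, and it carries the canonical map to the unit.\<close>

lemma unit_forget_sheafify_iso:
  assumes F: "psh F"
  shows "sheafify_unit G \<B> (\<Gamma> (\<L> F)) \<in> psh_iso G \<phi> \<B> (\<Gamma> (\<L> F)) (\<Gamma> (\<L> (\<Gamma> (\<L> F))))"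
proof -
  let ?E = "\<L> F" and ?E' = "\<L> (\<Gamma> (\<L> F))"
  have F': "psh (\<Gamma> ?E)" by (rule psh_forget_sheafify[OF F])
  obtain \<epsilon> where \<epsilon>: "\<epsilon> \<in> sheaf_hom G ?E' ?E" "sheaf_comp ?E \<epsilon> (can F) = sheaf_id ?E"
    "sheaf_comp ?E' (can F) \<epsilon> = sheaf_id ?E'"
    using can_inverse[OF F] by blast
  have "psh_comp \<B> (\<Gamma> ?E) (forget_map X \<B> ?E' \<epsilon>) (forget_map X \<B> ?E (can F)) = psh_id \<B> (\<Gamma> ?E)"
    unfolding forget_map_comp[OF can_hom[OF F], symmetric] \<epsilon>(2) by (rule forget_map_id)
  moreover have "psh_comp \<B> (\<Gamma> ?E') (forget_map X \<B> ?E (can F)) (forget_map X \<B> ?E' \<epsilon>) = psh_id \<B> (\<Gamma> ?E')"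
    unfolding forget_map_comp[OF \<epsilon>(1), symmetric] \<epsilon>(3) by (rule forget_map_id)
  moreover have "forget_map X \<B> ?E' \<epsilon> \<in> psh_hom G \<phi> \<B> (\<Gamma> ?E') (\<Gamma> ?E)"
    by (rule forget_map_hom[OF G_sheaf_sheafify[OF F'] \<epsilon>(1)])
  ultimately show ?thesis
    using unit_hom[OF F'] unfolding forget_map_can[OF F] psh_iso_def by blast
qed

text \<open>Surjectivity of the adjunction bijection, with the adjunct written out as a composite
  with the unit.\<close>

lemma factor_over_unit:
  assumes F: "psh F" and E: "shf E" and \<alpha>: "\<alpha> \<in> psh_hom G \<phi> \<B> F (\<Gamma> E)"
  shows "\<exists>f\<in>sheaf_hom G (\<L> F) E. \<alpha> = psh_comp \<B> F (forget_map X \<B> (\<L> F) f) (sheafify_unit G \<B> F)"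
  using bij_betw_imp_surj_on[OF adjunct_bij[OF F E]] \<alpha> unfolding adjunct_def by blast

end

theorem theorem4p5:
  fixes G :: "('g, 'm) monoid_scheme" and T :: "'g topology"
    and X :: "'x topology" and \<phi> :: "'g \<Rightarrow> 'x \<Rightarrow> 'x" and \<B> :: "'x set set"
  assumes "profinite_group G T"
    and "profinite_space X" and "G_space G T X \<phi>"
    and "open_closed_basis X \<B>"
  shows
    \<comment> \<open>the forgetful functor\<close>
    "(\<forall>E :: ('x, 'g, 'e1) sheaf. G_sheaf G T X \<phi> E \<longrightarrow>
        G_presheaf G T \<phi> \<B> (forget G X \<phi> E) \<and>
        forget_map X \<B> E (sheaf_id E) = psh_id \<B> (forget G X \<phi> E)) \<and>
     (\<forall>(E1 :: ('x, 'g, 'e1) sheaf) (E2 :: ('x, 'g, 'e2) sheaf).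
        G_sheaf G T X \<phi> E1 \<and> G_sheaf G T X \<phi> E2 \<longrightarrow>
        (\<forall>f\<in>sheaf_hom G E1 E2.
           forget_map X \<B> E1 f \<in> psh_hom G \<phi> \<B> (forget G X \<phi> E1) (forget G X \<phi> E2))) \<and>
     (\<forall>(E1 :: ('x, 'g, 'e1) sheaf) (E2 :: ('x, 'g, 'e2) sheaf) (E3 :: ('x, 'g, 'e3) sheaf).
        G_sheaf G T X \<phi> E1 \<and> G_sheaf G T X \<phi> E2 \<and> G_sheaf G T X \<phi> E3 \<longrightarrow>
        (\<forall>f\<in>sheaf_hom G E1 E2. \<forall>h\<in>sheaf_hom G E2 E3.
           forget_map X \<B> E1 (sheaf_comp E1 h f) =
           psh_comp \<B> (forget G X \<phi> E1) (forget_map X \<B> E2 h) (forget_map X \<B> E1 f))) \<and>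
     \<comment> \<open>equivariant sheafification is a functor\<close>
     (\<forall>F :: ('x, 'g, 'a1) presheaf. G_presheaf G T \<phi> \<B> F \<longrightarrow>
        G_sheaf G T X \<phi> (sheafify G X \<phi> \<B> F) \<and>
        sheafify_map G X \<B> F F (psh_id \<B> F) = sheaf_id (sheafify G X \<phi> \<B> F)) \<and>
     (\<forall>(F1 :: ('x, 'g, 'a1) presheaf) (F2 :: ('x, 'g, 'a2) presheaf).
        G_presheaf G T \<phi> \<B> F1 \<and> G_presheaf G T \<phi> \<B> F2 \<longrightarrow>
        (\<forall>\<alpha>\<in>psh_hom G \<phi> \<B> F1 F2.
           sheafify_map G X \<B> F1 F2 \<alpha> \<in>
             sheaf_hom G (sheafify G X \<phi> \<B> F1) (sheafify G X \<phi> \<B> F2))) \<and>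
     (\<forall>(F1 :: ('x, 'g, 'a1) presheaf) (F2 :: ('x, 'g, 'a2) presheaf) (F3 :: ('x, 'g, 'a3) presheaf).
        G_presheaf G T \<phi> \<B> F1 \<and> G_presheaf G T \<phi> \<B> F2 \<and> G_presheaf G T \<phi> \<B> F3 \<longrightarrow>
        (\<forall>\<alpha>\<in>psh_hom G \<phi> \<B> F1 F2. \<forall>\<beta>\<in>psh_hom G \<phi> \<B> F2 F3.
           sheafify_map G X \<B> F1 F3 (psh_comp \<B> F1 \<beta> \<alpha>) =
           sheaf_comp (sheafify G X \<phi> \<B> F1)
             (sheafify_map G X \<B> F2 F3 \<beta>) (sheafify_map G X \<B> F1 F2 \<alpha>))) \<and>
     \<comment> \<open>adjunction: bijection of hom-sets, natural in the sheaf and in the presheaf\<close>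
     (\<forall>(F :: ('x, 'g, 'a1) presheaf) (E :: ('x, 'g, 'e1) sheaf).
        G_presheaf G T \<phi> \<B> F \<and> G_sheaf G T X \<phi> E \<longrightarrow>
        bij_betw (adjunct G X \<phi> \<B> F)
          (sheaf_hom G (sheafify G X \<phi> \<B> F) E)
          (psh_hom G \<phi> \<B> F (forget G X \<phi> E))) \<and>
     (\<forall>(F :: ('x, 'g, 'a1) presheaf) (E1 :: ('x, 'g, 'e1) sheaf) (E2 :: ('x, 'g, 'e2) sheaf).
        G_presheaf G T \<phi> \<B> F \<and> G_sheaf G T X \<phi> E1 \<and> G_sheaf G T X \<phi> E2 \<longrightarrow>
        (\<forall>f\<in>sheaf_hom G (sheafify G X \<phi> \<B> F) E1. \<forall>h\<in>sheaf_hom G E1 E2.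
           adjunct G X \<phi> \<B> F (sheaf_comp (sheafify G X \<phi> \<B> F) h f) =
           psh_comp \<B> F (forget_map X \<B> E1 h) (adjunct G X \<phi> \<B> F f))) \<and>
     (\<forall>(F1 :: ('x, 'g, 'a1) presheaf) (F2 :: ('x, 'g, 'a2) presheaf) (E :: ('x, 'g, 'e1) sheaf).
        G_presheaf G T \<phi> \<B> F1 \<and> G_presheaf G T \<phi> \<B> F2 \<and> G_sheaf G T X \<phi> E \<longrightarrow>
        (\<forall>\<alpha>\<in>psh_hom G \<phi> \<B> F1 F2. \<forall>f\<in>sheaf_hom G (sheafify G X \<phi> \<B> F2) E.
           adjunct G X \<phi> \<B> F1
             (sheaf_comp (sheafify G X \<phi> \<B> F1) f (sheafify_map G X \<B> F1 F2 \<alpha>)) =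
           psh_comp \<B> F1 (adjunct G X \<phi> \<B> F2 f) \<alpha>)) \<and>
     \<comment> \<open>the unit\<close>
     (\<forall>F :: ('x, 'g, 'a1) presheaf. G_presheaf G T \<phi> \<B> F \<longrightarrow>
        sheafify_unit G \<B> F \<in> psh_hom G \<phi> \<B> F (forget G X \<phi> (sheafify G X \<phi> \<B> F)) \<and>
        adjunct G X \<phi> \<B> F (sheaf_id (sheafify G X \<phi> \<B> F)) = sheafify_unit G \<B> F) \<and>
     \<comment> \<open>the canonical map from the sheafification to its sheafification is an isomorphism,
       both as the map induced by the unit and as the unit at the sheafification; these agree\<close>
     (\<forall>F :: ('x, 'g, 'a1) presheaf. G_presheaf G T \<phi> \<B> F \<longrightarrow>
        (let lF = sheafify G X \<phi> \<B> F;
             \<Gamma>lF = forget G X \<phi> lF;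
             llF = sheafify G X \<phi> \<B> \<Gamma>lF;
             can = sheafify_map G X \<B> F \<Gamma>lF (sheafify_unit G \<B> F)
         in can \<in> sheaf_iso G lF llF \<and>
            forget_map X \<B> lF can = sheafify_unit G \<B> \<Gamma>lF \<and>
            sheafify_unit G \<B> \<Gamma>lF \<in> psh_iso G \<phi> \<B> \<Gamma>lF (forget G X \<phi> llF))) \<and>
     \<comment> \<open>maps from a presheaf to a sheaf factor over the unit\<close>
     (\<forall>(F :: ('x, 'g, 'a1) presheaf) (E :: ('x, 'g, 'e1) sheaf).
        G_presheaf G T \<phi> \<B> F \<and> G_sheaf G T X \<phi> E \<longrightarrow>
        (\<forall>\<alpha>\<in>psh_hom G \<phi> \<B> F (forget G X \<phi> E).
           \<exists>f\<in>sheaf_hom G (sheafify G X \<phi> \<B> F) E.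
             \<alpha> = psh_comp \<B> F (forget_map X \<B> (sheafify G X \<phi> \<B> F) f) (sheafify_unit G \<B> F)))"
proof -
  interpret G_basis G T X \<phi> \<B>
    using assms by unfold_locales (auto simp: profinite_group_def profinite_space_def)
  show ?thesis
    unfolding Let_def
    by (intro conjI allI impI ballI; (elim conjE)?)
      (assumption | rule G_presheaf_forget forget_map_id forget_map_hom forget_map_comp
        G_sheaf_sheafify sheafify_map_id sheafify_map_hom sheafify_map_comp
        adjunct_bij adjunct_natural_sheaf adjunct_natural_presheaf unit_hom adjunct_id
        can_iso forget_map_can unit_forget_sheafify_iso factor_over_unit)+
qed

end
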